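(* Let $m=m_n\to\infty$ and $p=p_n\to 0$ be sequences with $mp^2=o(1)$ and $n^2mp^2\to\infty$ as $n\to\infty$. There exists a constant $C>0$ such that for every $\varepsilon>0$ there exists $A_\varepsilon$ such that, for all sufficiently large $n$, if $$npe^{-mp}\ge A_\varepsilon,$$ then with probability at least $1-\varepsilon$ $$\operatorname{mod}(\mathcal{G}(n,m,p))\ge (1-C\varepsilon)e^{-mp}.$$
   Context: The random intersection graph $\mathcal{G}(n,m,p)$: there is a vertex set $\mathcal{V}=\{v_1,\dots,v_n\}$ and an attribute set $\mathcal{W}=\{w_1,\dots,w_m\}$. Each vertex $v_i$ receives a random subset $\mathcal{W}(v_i)\subseteq\mathcal{W}$, where each attribute $w\in\mathcal{W}$ is included in $\mathcal{W}(v_i)$ independently with probability $p$ (independently over all pairs $(v_i,w)$). Two distinct vertices $v_i,v_j$ are adjacent iff $\mathcal{W}(v_i)\cap\mathcal{W}(v_j)\neq\emptyset$. Modularity: for a graph $G$ with at least one edge, $e(G)$ is its number of edges, for $S\subseteq V(G)$, $e(S)$ is the number of edges with both ends in $S$ and $\operatorname{vol}(S)$ is the sum of degrees of vertices in $S$, $\operatorname{vol}(G)=\operatorname{vol}(V(G))$. For a partition $\mathcal{A}$ of $V(G)$, $\operatorname{mod}_{\mathcal{A}}(G)=\sum_{S\in\mathcal{A}}\left(\frac{e(S)}{e(G)}-\left(\frac{\operatorname{vol}(S)}{\operatorname{vol}(G)}\right)^2\right)$, and $\operatorname{mod}(G)=\max_{\mathcal{A}}\operatorname{mod}_{\mathcal{A}}(G)$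 over all partitions of $V(G)$. All asymptotics are as $n\to\infty$. *)

theory Defs
  imports "HOL-Probability.Probability" "HOL-Library.Disjoint_Sets" "HOL-Library.Landau_Symbols"
begin

text \<open>A simple graph is a pair of a vertex set and a set of edges, each edge being a
  two-element set of vertices.\<close>

type_synonym 'a graph = "'a set \<times> 'a set set"

abbreviation verts :: "'a graph \<Rightarrow> 'a set" where "verts \<equiv> fst"
abbreviation edges :: "'a graph \<Rightarrow> 'a set set" where "edges \<equiv> snd"

definition degree :: "'a graph \<Rightarrow> 'a \<Rightarrow> nat" where
  "degree G v = card {e \<in> edges G. v \<in> e}"

definition num_edges_in :: "'a graph \<Rightarrow> 'a set \<Rightarrow> nat" where
  "num_edges_in G S = card {e \<in> edges G. e \<subseteq> S}"

definition vol :: "'a graph \<Rightarrow> 'a set \<Rightarrow> nat" where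
  "vol G S = (\<Sum>v\<in>S. degree G v)"

definition modularity_of :: "'a graph \<Rightarrow> 'a set set \<Rightarrow> real" where
  "modularity_of G \<A> = (\<Sum>S\<in>\<A>.
     real (num_edges_in G S) / real (card (edges G)) -
     (real (vol G S) / real (vol G (verts G)))\<^sup>2)"

text \<open>Only meaningful for finite graphs with at least one edge; on an edgeless graph the
  divisions by zero make the value \<open>0\<close>.\<close>

definition modularity :: "'a graph \<Rightarrow> real" where
  "modularity G = Max {modularity_of G \<A> |\<A>. partition_on (verts G) \<A>}"

lemma modularity_set_finite_nonempty:
  assumes "finite (verts G)"
  shows "finite {modularity_of G \<A> |\<A>. partition_on (verts G) \<A>}"
    and "{modularity_of G \<A> |\<A>. partition_on (verts G) \<A>} \<noteq> {}"
proof -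
  show "finite {modularity_of G \<A> |\<A>. partition_on (verts G) \<A>}"
    using finitely_many_partition_on[OF assms] by (simp add: setcompr_eq_image)
  have "\<exists>\<A>. partition_on (verts G) \<A>"
    by (metis partition_on_empty partition_on_space)
  then show "{modularity_of G \<A> |\<A>. partition_on (verts G) \<A>} \<noteq> {}"
    by blast
qed

text \<open>The intersection graph on \<open>V\<close> in which vertex \<open>v\<close> has attribute set \<open>W v\<close>.\<close>

definition intersection_graph :: "'v set \<Rightarrow> ('v \<Rightarrow> 'w set) \<Rightarrow> 'v graph" where
  "intersection_graph V W =
     (V, {{u, v} |u v. u \<in> V \<and> v \<in> V \<and> u \<noteq> v \<and> W u \<inter> W v \<noteq> {}})"

text \<open>Vertices are \<open>{..<n}\<close> and attributes \<open>{..<m}\<close>; \<open>X (v, w)\<close> is the indicator that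
  attribute \<open>w\<close> is given to vertex \<open>v\<close>.\<close>

definition random_intersection_graph :: "nat \<Rightarrow> nat \<Rightarrow> real \<Rightarrow> nat graph pmf" where
  "random_intersection_graph n m p =
     map_pmf (\<lambda>X. intersection_graph {..<n} (\<lambda>v. {w \<in> {..<m}. X (v, w)}))
       (Pi_pmf ({..<n} \<times> {..<m}) False (\<lambda>_. bernoulli_pmf p))"

end

theory Submission imports Defs begin

text \<open>
  Partition the vertices according to their least attribute, for the fixed order of
  \<open>{..<m}\<close>. A pair of vertices shares its least attribute with probability
  \<open>\<eta> = (\<Sum>w<m. (p * (1 - p) ^ w)\<^sup>2) \<ge> p * (1 - exp (-2 * m * p)) / 2 \<ge> m * p\<^sup>2 * exp (-m * p)\<close>,
  the last step being \<open>sinh x \<ge> x\<close>, whereas it is adjacent with probability at most \<open>m * p\<^sup>2\<close>.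
  The attribute sets of the vertices are independent and identically distributed, hence the
  numbers of edges and of edges inside a class are sums of a kernel over pairs of i.i.d.
  variables, and Chebyshev's inequality shows that both are concentrated. The
  sum of the squared class volumes is a sum of products of two degrees over pairs of vertices
  in the same class; conditioning on the attribute sets of the two vertices bounds its
  expectation, and Markov's inequality makes it negligible. All error terms are of order
  \<open>1 / m + p + m * p\<^sup>2\<close> as soon as \<open>n * p * exp (-m * p) \<ge> 1\<close>, so \<open>A = 1\<close> works for every \<open>\<epsilon>\<close>.
\<close>

subsection \<open>Products of identical distributions\<close>

lemma finite_set_Pi_pmf:
  assumes "finite A" "\<And>x. x \<in> A \<Longrightarrow> finite (set_pmf (q x))"
  shows "finite (set_pmf (Pi_pmf A d q))"
  using assms by (simp add: set_Pi_pmf finite_PiE_dflt)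

text \<open>Regrouping a matrix of independent entries by rows. \<open>case_prod\<close> is
  injective, so the two mass functions can be compared at each point: on families equal to
  \<open>d\<close> outside the rectangle both are the same double product, elsewhere both
  vanish.\<close>

lemma Pi_pmf_Times:
  fixes A :: "'a set" and B :: "'b set" and d :: 'c
  assumes "finite A" "finite B"
  shows "Pi_pmf (A \<times> B) d (\<lambda>_. q) =
    map_pmf case_prod (Pi_pmf A (\<lambda>_. d) (\<lambda>_. Pi_pmf B d (\<lambda>_. q)))"
proof (rule pmf_eqI)
  fix Y :: "'a \<times> 'b \<Rightarrow> 'c"
  define X where "X = (\<lambda>a b. Y (a, b))"
  have Y: "Y = case_prod X" by (auto simp: X_def)
  have inj: "inj (case_prod :: ('a \<Rightarrow> 'b \<Rightarrow> 'c) \<Rightarrow> _)"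
    by (rule injI) (metis curry_case_prod)
  have "pmf (map_pmf case_prod (Pi_pmf A (\<lambda>_. d) (\<lambda>_. Pi_pmf B d (\<lambda>_. q)))) Y =
      pmf (Pi_pmf A (\<lambda>_. d) (\<lambda>_. Pi_pmf B d (\<lambda>_. q))) X"
    unfolding Y by (rule pmf_map_inj'[OF inj])
  also have "\<dots> = pmf (Pi_pmf (A \<times> B) d (\<lambda>_. q)) Y"
  proof (cases "\<forall>a b. (a, b) \<notin> A \<times> B \<longrightarrow> X a b = d")
    case True
    then show ?thesis using assms
      by (auto simp: pmf_Pi X_def fun_eq_iff prod.cartesian_product)
  next
    case False
    then obtain a b where ab: "(a, b) \<notin> A \<times> B" "X a b \<noteq> d" by blast
    have "pmf (Pi_pmf (A \<times> B) d (\<lambda>_. q)) Y = 0"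
      using assms ab by (intro pmf_Pi_outside) (auto simp: X_def)
    \<comment> \<open>A wrong default is detected at different levels: for \<open>a \<in> A\<close>
      the factor of row \<open>a\<close> is zero, while for \<open>a \<notin> A\<close> the whole
      row differs from the default row.\<close>
    moreover have "pmf (Pi_pmf A (\<lambda>_. d) (\<lambda>_. Pi_pmf B d (\<lambda>_. q))) X = 0"
    proof (cases "a \<in> A")
      case True
      then have "pmf (Pi_pmf B d (\<lambda>_. q)) (X a) = 0"
        using assms ab by (intro pmf_Pi_outside) auto
      with True show ?thesis
        by (subst pmf_Pi) (use assms in \<open>auto intro!: prod_zero\<close>)
    next
      case False
      then show ?thesis using assms ab by (intro pmf_Pi_outside) (auto simp: fun_eq_iff)
    qed
    ultimately show ?thesis by simp
  qed
  finally show "pmf (Pi_pmf (A \<times> B) d (\<lambda>_. q)) Y =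
      pmf (map_pmf case_prod (Pi_pmf A (\<lambda>_. d) (\<lambda>_. Pi_pmf B d (\<lambda>_. q)))) Y" ..
qed

definition random_subset :: "nat \<Rightarrow> real \<Rightarrow> nat set pmf" where
  "random_subset m p =
     map_pmf (\<lambda>x. {w \<in> {..<m}. x w}) (Pi_pmf {..<m} False (\<lambda>_. bernoulli_pmf p))"

text \<open>Grouping the indicators by vertex exhibits the graph as a function of independent,
  identically distributed attribute sets, the form used from here on. The default \<open>{}\<close>
  is the image of the all-\<open>False\<close> row.\<close>

lemma random_intersection_graph_altdef:
  "random_intersection_graph n m p =
     map_pmf (intersection_graph {..<n}) (Pi_pmf {..<n} {} (\<lambda>_. random_subset m p))"
  unfolding random_intersection_graph_def random_subset_def
  by (subst Pi_pmf_map[where dflt = "\<lambda>_. False"])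
     (auto simp: Pi_pmf_Times pmf.map_comp o_def)

text \<open>Fubini for one coordinate. The support of \<open>R\<close> is finite, so all integrals
  are finite sums and no integrability has to be checked. Peeling off several coordinates in turn
  yields the product formulas below.\<close>

lemma expectation_Pi_pmf_remove:
  fixes F :: "('i \<Rightarrow> 'a) \<Rightarrow> real"
  assumes A: "finite A" "u \<in> A" and R: "finite (set_pmf R)"
  shows "measure_pmf.expectation (Pi_pmf A d (\<lambda>_. R)) F =
    measure_pmf.expectation R (\<lambda>s.
      measure_pmf.expectation (Pi_pmf (A - {u}) d (\<lambda>_. R)) (\<lambda>W. F (W(u := s))))"
proof -
  let ?P = "Pi_pmf (A - {u}) d (\<lambda>_. R)"
  have fin: "finite (set_pmf ?P)" by (intro finite_set_Pi_pmf) (use A R in auto)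
  have "Pi_pmf A d (\<lambda>_. R) = Pi_pmf (insert u (A - {u})) d (\<lambda>_. R)"
    using A by (simp add: insert_absorb)
  also have "\<dots> = R \<bind> (\<lambda>s. map_pmf (\<lambda>W. W(u := s)) ?P)"
    using A by (subst Pi_pmf_insert') (auto simp: map_pmf_def)
  finally have *: "Pi_pmf A d (\<lambda>_. R) = R \<bind> (\<lambda>s. map_pmf (\<lambda>W. W(u := s)) ?P)" .
  show ?thesis unfolding *
    by (subst pmf_expectation_bind[where A = "set_pmf R"])
       (use R fin in \<open>auto simp: integral_measure_pmf[of "set_pmf R"] mult.commute\<close>)
qed

abbreviation iid :: "'i set \<Rightarrow> 'a \<Rightarrow> 'a pmf \<Rightarrow> ('i \<Rightarrow> 'a) pmf" where
  "iid A d R \<equiv> Pi_pmf A d (\<lambda>_. R)"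

lemma expectation_iid_2:
  fixes f :: "'a \<Rightarrow> 'a \<Rightarrow> real"
  assumes "finite A" "u \<in> A" "v \<in> A" "u \<noteq> v" "finite (set_pmf R)"
  shows "measure_pmf.expectation (iid A d R) (\<lambda>W. f (W u) (W v)) =
    measure_pmf.expectation R (\<lambda>s. measure_pmf.expectation R (f s))"
  using assms
  by (simp add: expectation_Pi_pmf_remove[where u = u] expectation_Pi_pmf_remove[where u = v])

text \<open>Conditionally on the common coordinate \<open>u\<close>, the two factors depend on
  different independent coordinates.\<close>

lemma expectation_iid_star:
  fixes f g :: "'a \<Rightarrow> 'a \<Rightarrow> real"
  assumes "finite A" "u \<in> A" "v \<in> A" "x \<in> A" "u \<noteq> v" "u \<noteq> x" "v \<noteq> x" "finite (set_pmf R)"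
  shows "measure_pmf.expectation (iid A d R) (\<lambda>W. f (W u) (W v) * g (W u) (W x)) =
    measure_pmf.expectation R
      (\<lambda>s. measure_pmf.expectation R (f s) * measure_pmf.expectation R (g s))"
  using assms
  by (simp add: expectation_Pi_pmf_remove[where u = u] expectation_Pi_pmf_remove[where u = v]
        expectation_Pi_pmf_remove[where u = x])

lemma expectation_iid_2_2:
  fixes f g :: "'a \<Rightarrow> 'a \<Rightarrow> real"
  assumes "finite A" "u \<in> A" "v \<in> A" "x \<in> A" "y \<in> A" "distinct [u, v, x, y]"
    "finite (set_pmf R)"
  shows "measure_pmf.expectation (iid A d R) (\<lambda>W. f (W u) (W v) * g (W x) (W y)) =
    measure_pmf.expectation R (\<lambda>s. measure_pmf.expectation R (f s)) *
    measure_pmf.expectation R (\<lambda>s. measure_pmf.expectation R (g s))"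
proof -
  from assms have "u \<noteq> v" "u \<noteq> x" "u \<noteq> y" "v \<noteq> x" "v \<noteq> y" "x \<noteq> y" by auto
  with assms show ?thesis
    by (simp add: expectation_Pi_pmf_remove[where u = u] expectation_Pi_pmf_remove[where u = v]
        expectation_Pi_pmf_remove[where u = x] expectation_Pi_pmf_remove[where u = y])
qed

subsection \<open>Second moments of sums over pairs of i.i.d. variables\<close>

definition off_diag :: "nat \<Rightarrow> (nat \<times> nat) set" where
  "off_diag n = {(u, v). u < n \<and> v < n \<and> u \<noteq> v}"

lemma off_diag_altdef: "off_diag n = {..<n} \<times> {..<n} - (\<lambda>u. (u, u)) ` {..<n}"
  by (auto simp: off_diag_def)

lemma finite_off_diag [simp]: "finite (off_diag n)"
  by (simp add: off_diag_altdef)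

lemma card_off_diag: "real (card (off_diag n)) = real n * (real n - 1)"
proof -
  have "card (off_diag n) = n * n - n"
    unfolding off_diag_altdef
    by (subst card_Diff_subset) (auto simp: card_image inj_on_def)
  then show ?thesis by (simp add: of_nat_diff algebra_simps)
qed

text \<open>Pairs are ordered, so an adjacency kernel counts every edge twice; the sum is then the
  volume of the graph.\<close>

definition pair_sum :: "nat \<Rightarrow> ('a \<Rightarrow> 'a \<Rightarrow> real) \<Rightarrow> (nat \<Rightarrow> 'a) \<Rightarrow> real" where
  "pair_sum n f W = (\<Sum>(u, v)\<in>off_diag n. f (W u) (W v))"

text \<open>Used to count the pairs with one prescribed coordinate, the injection being the
  projection to the other coordinate.\<close>

lemma sum_of_bool_le_by_inj:
  fixes n :: nat
  assumes "inj_on h {e \<in> S. P e}" "\<And>e. e \<in> S \<Longrightarrow> P e \<Longrightarrow> h e < n" "finite S"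
  shows "(\<Sum>e\<in>S. of_bool (P e) :: real) \<le> real n"
proof -
  have "card {e \<in> S. P e} \<le> card {..<n}"
    by (rule card_inj_on_le[of h]) (use assms in auto)
  then show ?thesis using assms(3) by (simp add: sum_of_bool_eq Int_def)
qed

text \<open>Expand the square and compare each product with \<theta>^2. \<open>K\<close> bounds the
  variance of the conditional mean of \<open>f\<close> given its first argument, which is the
  covariance of two pairs sharing one index; each pair shares an index in a given position with at
  most \<open>n\<close> others, and there are four choices of positions.\<close>

lemma pair_sum_moments:
  fixes f :: "'a \<Rightarrow> 'a \<Rightarrow> real" and R :: "'a pmf" and n :: nat
  assumes R: "finite (set_pmf R)" and sym: "\<And>s t. f s t = f t s"
    and f01: "\<And>s t. 0 \<le> f s t" "\<And>s t. f s t \<le> 1"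
    and \<theta>: "\<theta> = measure_pmf.expectation R (\<lambda>s. measure_pmf.expectation R (f s))"
    and K: "0 \<le> K"
      "measure_pmf.expectation R (\<lambda>s. (measure_pmf.expectation R (f s))\<^sup>2) \<le> \<theta>\<^sup>2 + K"
  defines "M \<equiv> real n * (real n - 1)"
  shows "measure_pmf.expectation (iid {..<n} d R) (pair_sum n f) = M * \<theta>"
    and "measure_pmf.expectation (iid {..<n} d R) (\<lambda>W. (pair_sum n f W)\<^sup>2) \<le>
      (M * \<theta>)\<^sup>2 + (2 * M * \<theta> + 4 * real n ^ 3 * K)"
proof -
  let ?E = "measure_pmf.expectation (iid {..<n} d R)"
  let ?D = "off_diag n"
  have int [simp]: "integrable (measure_pmf (iid {..<n} d R)) F" for F :: "_ \<Rightarrow> real"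
    by (intro integrable_measure_pmf_finite finite_set_Pi_pmf) (use R in auto)
  have \<theta>0: "0 \<le> \<theta>" unfolding \<theta> by (intro integral_nonneg_AE AE_pmfI f01)
  have two: "?E (\<lambda>W. f (W u) (W v)) = \<theta>" if "(u, v) \<in> ?D" for u v
    using that R unfolding \<theta> by (subst expectation_iid_2) (auto simp: off_diag_def)
  show "?E (pair_sum n f) = M * \<theta>"
    unfolding pair_sum_def
    by (simp add: case_prod_unfold) (simp add: two card_off_diag M_def)
  have star: "?E (\<lambda>W. f (W u) (W v) * f (W u) (W x)) \<le> \<theta>\<^sup>2 + K"
    if "u < n" "v < n" "x < n" "u \<noteq> v" "u \<noteq> x" "v \<noteq> x" for u v x
    using that R K by (subst expectation_iid_star) (auto simp: power2_eq_square)
  have same: "?E (\<lambda>W. f (W u) (W v) * f (W u) (W v)) \<le> \<theta>" if "(u, v) \<in> ?D" for u v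
  proof -
    have "?E (\<lambda>W. f (W u) (W v) * f (W u) (W v)) \<le> ?E (\<lambda>W. f (W u) (W v))"
      by (intro integral_mono int mult_left_le f01)
    then show ?thesis using two[OF that] by simp
  qed
  \<comment> \<open>Two pairs of indices that are disjoint contribute independent terms; a common index costs
    \<open>K\<close>, and equality up to order costs \<open>\<theta>\<close>.\<close>
  define B :: "nat \<times> nat \<Rightarrow> nat \<times> nat \<Rightarrow> real" where "B = (\<lambda>e g.
     of_bool (g = e) * \<theta> + of_bool (g = prod.swap e) * \<theta> +
     (of_bool (fst g = fst e) * K + of_bool (fst g = snd e) * K +
      of_bool (snd g = fst e) * K + of_bool (snd g = snd e) * K))"
  have cov: "?E (\<lambda>W. f (W u) (W v) * f (W x) (W y)) \<le> \<theta>\<^sup>2 + B (u, v) (x, y)"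
    if D: "(u, v) \<in> ?D" "(x, y) \<in> ?D" for u v x y
  proof -
    have D': "u < n" "v < n" "u \<noteq> v" "x < n" "y < n" "x \<noteq> y"
      using D by (auto simp: off_diag_def)
    have tt: "0 \<le> \<theta>\<^sup>2" by simp
    \<comment> \<open>The first two cases are equal pairs up to order, the next four share an index,
      the last is disjoint. Symmetry of \<open>f\<close> moves the shared index to the first
      argument, where \<open>star\<close> applies.\<close>
    consider "x = u" "y = v" | "x = v" "y = u" | "x = u" "y \<noteq> v" | "x = v" "y \<noteq> u"
      | "y = u" "x \<noteq> v" | "y = v" "x \<noteq> u" | "x \<noteq> u" "x \<noteq> v" "y \<noteq> u" "y \<noteq> v" by blast
    then show ?thesis
    proof cases
      case 1
      then show ?thesis using same[OF D(1)] D' K(1) by (simp add: B_def) (use tt in linarith)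
    next
      case 2
      then show ?thesis using same[OF D(1)] sym[of "W v" "W u" for W] D' K(1)
        by (simp add: B_def) (use tt in linarith)
    next
      case 3
      then show ?thesis using star[of u v y] D' K(1) by (simp add: B_def)
    next
      case 4
      then show ?thesis using star[of v u y] D' K(1) sym[of "W u" "W v" for W]
        by (simp add: B_def)
    next
      case 5
      then show ?thesis using star[of u v x] D' K(1) sym[of "W x" "W u" for W]
        by (simp add: B_def)
    next
      case 6
      then show ?thesis using star[of v u x] D' K(1) sym[of "W x" "W v" for W]
          sym[of "W u" "W v" for W] by (simp add: B_def)
    next
      case 7
      then have "?E (\<lambda>W. f (W u) (W v) * f (W x) (W y)) = \<theta> * \<theta>"
        unfolding \<theta> using D' R by (intro expectation_iid_2_2) auto
      then show ?thesis using 7 by (simp add: B_def power2_eq_square)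
    qed
  qed
  have B_sum: "(\<Sum>g\<in>?D. B e g) \<le> 2 * \<theta> + 4 * real n * K" if "e \<in> ?D" for e
  proof -
    have 1: "(\<Sum>g\<in>?D. of_bool (g = x) * \<theta>) \<le> \<theta>" for x
      using \<theta>0 by (simp add: of_bool_def if_distrib[of "\<lambda>z. z * _"] sum.delta cong: if_cong)
    have 2: "(\<Sum>g\<in>?D. of_bool (fst g = x) * K) \<le> real n * K" for x
    proof -
      have "(\<Sum>g\<in>?D. of_bool (fst g = x) :: real) \<le> real n"
        by (rule sum_of_bool_le_by_inj[of snd, OF _ _ finite_off_diag]) (auto simp: inj_on_def off_diag_def)
      then show ?thesis using K(1) by (simp add: sum_distrib_right[symmetric] mult_right_mono)
    qed
    have 3: "(\<Sum>g\<in>?D. of_bool (snd g = x) * K) \<le> real n * K" for x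
    proof -
      have "(\<Sum>g\<in>?D. of_bool (snd g = x) :: real) \<le> real n"
        by (rule sum_of_bool_le_by_inj[of fst, OF _ _ finite_off_diag]) (auto simp: inj_on_def off_diag_def)
      then show ?thesis using K(1) by (simp add: sum_distrib_right[symmetric] mult_right_mono)
    qed
    show ?thesis
      using 1[of e] 1[of "prod.swap e"] 2[of "fst e"] 2[of "snd e"] 3[of "fst e"] 3[of "snd e"]
      unfolding B_def sum.distrib by linarith
  qed
  have M: "real (card ?D) = M" "M \<le> real n ^ 2"
    by (auto simp: M_def card_off_diag power2_eq_square algebra_simps)
  then have "0 \<le> M" by (metis of_nat_0_le_iff)
  have "?E (\<lambda>W. (pair_sum n f W)\<^sup>2) =
      (\<Sum>e\<in>?D. \<Sum>g\<in>?D. ?E (\<lambda>W. f (W (fst e)) (W (snd e)) * f (W (fst g)) (W (snd g))))"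
    by (simp add: pair_sum_def power2_eq_square case_prod_unfold sum_product)
  also have "\<dots> \<le> (\<Sum>e\<in>?D. \<Sum>g\<in>?D. \<theta>\<^sup>2 + B e g)"
    by (intro sum_mono) (use cov in force)
  also have "\<dots> \<le> (\<Sum>e\<in>?D. M * \<theta>\<^sup>2 + (2 * \<theta> + 4 * real n * K))"
    using B_sum by (intro sum_mono) (simp add: sum.distrib M)
  also have "\<dots> = (M * \<theta>)\<^sup>2 + 2 * M * \<theta> + 4 * real n * K * M"
    by (simp add: M power2_eq_square algebra_simps)
  also have "4 * real n * K * M \<le> 4 * real n * K * real n ^ 2"
    using M \<open>0 \<le> M\<close> K by (intro mult_left_mono) auto
  also have "\<dots> = 4 * real n ^ 3 * K" by (simp add: power2_eq_square power3_eq_cube)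
  finally show "?E (\<lambda>W. (pair_sum n f W)\<^sup>2) \<le>
      (M * \<theta>)\<^sup>2 + (2 * M * \<theta> + 4 * real n ^ 3 * K)" by simp
qed

lemma pair_sum_concentration:
  fixes f :: "'a \<Rightarrow> 'a \<Rightarrow> real" and R :: "'a pmf" and n :: nat
  assumes R: "finite (set_pmf R)" and sym: "\<And>s t. f s t = f t s"
    and f01: "\<And>s t. 0 \<le> f s t" "\<And>s t. f s t \<le> 1"
    and \<theta>: "\<theta> = measure_pmf.expectation R (\<lambda>s. measure_pmf.expectation R (f s))"
    and K: "0 \<le> K"
      "measure_pmf.expectation R (\<lambda>s. (measure_pmf.expectation R (f s))\<^sup>2) \<le> \<theta>\<^sup>2 + K"
  defines "M \<equiv> real n * (real n - 1)"
  assumes \<delta>: "0 < \<delta>" "0 < M * \<theta>"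
  shows "measure_pmf.prob (iid {..<n} d R) {W. \<bar>pair_sum n f W - M * \<theta>\<bar> \<ge> \<delta> * (M * \<theta>)} \<le>
    (2 * M * \<theta> + 4 * real n ^ 3 * K) / (\<delta> * (M * \<theta>))\<^sup>2"
proof -
  let ?P = "iid {..<n} d R"
  have int [simp]: "integrable (measure_pmf ?P) F" for F :: "_ \<Rightarrow> real"
    by (intro integrable_measure_pmf_finite finite_set_Pi_pmf) (use R in auto)
  note m = pair_sum_moments[OF R sym f01 \<theta> K, of n d, folded M_def]
  have "measure_pmf.prob ?P {W. \<bar>pair_sum n f W - M * \<theta>\<bar> \<ge> \<delta> * (M * \<theta>)} \<le>
      measure_pmf.variance ?P (pair_sum n f) / (\<delta> * (M * \<theta>))\<^sup>2"
    using measure_pmf.Chebyshev_inequality[of "pair_sum n f" ?P "\<delta> * (M * \<theta>)"] \<delta>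
    by (simp add: m)
  also have "measure_pmf.variance ?P (pair_sum n f) =
      measure_pmf.expectation ?P (\<lambda>W. (pair_sum n f W)\<^sup>2) - (M * \<theta>)\<^sup>2"
    by (subst measure_pmf.variance_eq) (simp_all add: m)
  also have "\<dots> \<le> 2 * M * \<theta> + 4 * real n ^ 3 * K" using m(2) by linarith
  finally show ?thesis by (simp add: divide_right_mono)
qed

section \<open>Expected sum of squared class volumes\<close>

lemma expectation_sum_times_sum_le:
  fixes \<alpha> \<beta> :: "'a \<Rightarrow> real"
  assumes "finite B" and R: "finite (set_pmf R)"
    and \<alpha>: "\<And>s. 0 \<le> \<alpha> s" and \<beta>: "\<And>s. 0 \<le> \<beta> s" "\<And>s. \<beta> s \<le> 1"
  shows "measure_pmf.expectation (iid B d R) (\<lambda>W. (\<Sum>x\<in>B. \<alpha> (W x)) * (\<Sum>y\<in>B. \<beta> (W y))) \<le>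
    (real (card B))\<^sup>2 * (measure_pmf.expectation R \<alpha> * measure_pmf.expectation R \<beta>) +
    real (card B) * measure_pmf.expectation R \<alpha>"
proof -
  let ?E = "measure_pmf.expectation (iid B d R)"
  have int [simp]: "integrable (measure_pmf (iid B d R)) F" for F :: "_ \<Rightarrow> real"
    by (intro integrable_measure_pmf_finite finite_set_Pi_pmf) (use assms in auto)
  have int' [simp]: "integrable (measure_pmf R) F" for F :: "_ \<Rightarrow> real"
    by (intro integrable_measure_pmf_finite R)
  let ?a = "measure_pmf.expectation R \<alpha>" and ?b = "measure_pmf.expectation R \<beta>"
  have ab: "0 \<le> ?a" "0 \<le> ?b" using \<alpha> \<beta> by (auto intro!: integral_nonneg_AE)
  \<comment> \<open>Distinct coordinates are independent; on the diagonal only \<beta> \<le> 1 is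
    used, which leaves the mean of \<alpha>.\<close>
  have cross: "?E (\<lambda>W. \<alpha> (W x) * \<beta> (W y)) \<le> ?a * ?b + of_bool (x = y) * ?a"
    if "x \<in> B" "y \<in> B" for x y
  proof (cases "x = y")
    case True
    have "?E (\<lambda>W. \<alpha> (W x) * \<beta> (W x)) \<le> ?E (\<lambda>W. \<alpha> (W x))"
      by (intro integral_mono int mult_left_le \<alpha> \<beta>)
    also have "\<dots> = ?a"
      using that assms by (simp add: expectation_Pi_pmf_remove[where u = x])
    finally show ?thesis using True ab by (simp add: add_increasing)
  next
    case False
    then show ?thesis
      using that assms by (subst expectation_iid_2) auto
  qed
  have "?E (\<lambda>W. (\<Sum>x\<in>B. \<alpha> (W x)) * (\<Sum>y\<in>B. \<beta> (W y))) =
      (\<Sum>x\<in>B. \<Sum>y\<in>B. ?E (\<lambda>W. \<alpha> (W x) * \<beta> (W y)))"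
    by (simp add: sum_product)
  also have "\<dots> \<le> (\<Sum>x\<in>B. \<Sum>y\<in>B. ?a * ?b + of_bool (x = y) * ?a)"
    by (intro sum_mono cross)
  also have "\<dots> = (\<Sum>x\<in>B. real (card B) * (?a * ?b) + ?a)"
    using assms(1) by (intro sum.cong) (auto simp: sum.distrib of_bool_def if_distrib[of "\<lambda>z. z * _"] cong: if_cong)
  also have "\<dots> = (real (card B))\<^sup>2 * (?a * ?b) + real (card B) * ?a"
    by (simp add: power2_eq_square algebra_simps)
  finally show ?thesis .
qed

definition row_sum :: "nat \<Rightarrow> ('a \<Rightarrow> 'a \<Rightarrow> real) \<Rightarrow> (nat \<Rightarrow> 'a) \<Rightarrow> nat \<Rightarrow> real" where
  "row_sum n f W u = (\<Sum>x\<in>{..<n} - {u}. f (W u) (W x))"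

text \<open>In the application \<open>c w\<close> is the indicator of class \<open>w\<close>,
  \<open>h\<close> is adjacency and \<open>a\<close> is the number of attributes. Given the values
  at \<open>u\<close> and \<open>v\<close>, each row sum has mean at most about
  \<open>n * p * a\<close>. The first term of the bound collects the pairs
  \<open>u \<noteq> v\<close>, the second the diagonal. As \<open>a\<close> is 0 or at least 1 and
  \<open>n * p\<close> is at least 1, terms of lower degree are absorbed into quadratic
  ones.\<close>

lemma expectation_class_volumes_le:
  fixes h :: "'a \<Rightarrow> 'a \<Rightarrow> real" and c :: "'k \<Rightarrow> 'a \<Rightarrow> real" and a :: "'a \<Rightarrow> real"
    and p :: real and n :: nat
  assumes R: "finite (set_pmf R)"
    and h: "\<And>s t. 0 \<le> h s t" "\<And>s t. h s t \<le> 1"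
    and hR: "\<And>s. measure_pmf.expectation R (h s) \<le> p * a s"
    and a: "\<And>s. a s = 0 \<or> 1 \<le> a s"
    and I: "finite I"
    and c: "\<And>w s. w \<in> I \<Longrightarrow> 0 \<le> c w s" "\<And>w s. w \<in> I \<Longrightarrow> c w s \<noteq> 0 \<Longrightarrow> 1 \<le> a s"
      "\<And>s. (\<Sum>w\<in>I. c w s * c w s) \<le> 1"
    and np: "1 \<le> real n * p"
  shows "measure_pmf.expectation (iid {..<n} d R)
      (\<lambda>W. \<Sum>u<n. \<Sum>v<n. (\<Sum>w\<in>I. c w (W u) * c w (W v)) * (row_sum n h W u * row_sum n h W v)) \<le>
    5 * (real n)\<^sup>2 * (real n * p)\<^sup>2 * (\<Sum>w\<in>I. (measure_pmf.expectation R (\<lambda>s. c w s * a s))\<^sup>2) +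
    2 * real n * (real n * p)\<^sup>2 * measure_pmf.expectation R (\<lambda>s. (a s)\<^sup>2)"
proof -
  have int [simp]: "integrable (measure_pmf (iid B d R)) F"
    if "finite B" for B :: "nat set" and F :: "_ \<Rightarrow> real"
    by (intro integrable_measure_pmf_finite finite_set_Pi_pmf) (use that R in auto)
  have int' [simp]: "integrable (measure_pmf R) F" for F :: "_ \<Rightarrow> real"
    by (intro integrable_measure_pmf_finite R)
  let ?E = "measure_pmf.expectation (iid {..<n} d R)"
  let ?ER = "measure_pmf.expectation R"
  define s where "s = (\<lambda>S T. \<Sum>w\<in>I. c w S * c w T)"
  have s0: "0 \<le> s S T" for S T unfolding s_def by (intro sum_nonneg mult_nonneg_nonneg c)
  have p0: "0 < p" using np by (metis less_le_trans mult_nonneg_nonpos not_le of_nat_0_le_iff zero_less_one)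
  have a0: "0 \<le> a S" for S using a[of S] by auto
  have g0: "0 \<le> ?ER (h S)" for S by (intro integral_nonneg_AE) (use h in auto)
  have ng: "real k * ?ER (h S) \<le> real n * p * a S" if "k \<le> n" for k S
  proof -
    have "real k * ?ER (h S) \<le> real n * (p * a S)"
      using that g0 hR by (intro mult_mono) auto
    then show ?thesis by (simp add: mult.assoc)
  qed
  have diag: "?E (\<lambda>W. s (W u) (W u) * (row_sum n h W u * row_sum n h W u)) \<le>
      2 * (real n * p)\<^sup>2 * ?ER (\<lambda>S. (a S)\<^sup>2)" if u: "u < n" for u
  proof -
    let ?B = "{..<n} - {u}"
    have inner: "measure_pmf.expectation (iid ?B d R)
        (\<lambda>W. (\<Sum>x\<in>?B. h S (W x)) * (\<Sum>x\<in>?B. h S (W x))) \<le> 2 * (real n * p)\<^sup>2 * (a S)\<^sup>2" for S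
    proof -
      have k: "card ?B \<le> n" by (metis card_Diff1_le card_lessThan finite_lessThan)
      \<comment> \<open>A number that is 0 or at least 1 is at most its own square.\<close>
      have z: "real n * p * a S \<le> (real n * p * a S) * (real n * p * a S)"
      proof (cases "a S = 0")
        case False
        then have "1 * 1 \<le> real n * p * a S" using a[of S] np by (intro mult_mono) auto
        then show ?thesis
          using mult_left_mono[of 1 "real n * p * a S" "real n * p * a S"] by linarith
      qed simp
      have "measure_pmf.expectation (iid ?B d R)
          (\<lambda>W. (\<Sum>x\<in>?B. h S (W x)) * (\<Sum>x\<in>?B. h S (W x))) \<le>
          (real (card ?B))\<^sup>2 * (?ER (h S) * ?ER (h S)) + real (card ?B) * ?ER (h S)"
        by (rule expectation_sum_times_sum_le) (use R h in auto)
      also have "\<dots> = (real (card ?B) * ?ER (h S)) * (real (card ?B) * ?ER (h S)) + real (card ?B) * ?ER (h S)"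
        by (simp add: power2_eq_square algebra_simps)
      also have "\<dots> \<le> (real n * p * a S) * (real n * p * a S) + real n * p * a S"
        by (intro add_mono mult_mono ng k mult_nonneg_nonneg g0 a0) (use p0 in auto)
      also have "\<dots> \<le> 2 * ((real n * p * a S) * (real n * p * a S))"
        using z by linarith
      finally show ?thesis by (simp add: power2_eq_square algebra_simps)
    qed
    have "?E (\<lambda>W. s (W u) (W u) * (row_sum n h W u * row_sum n h W u)) \<le>
        ?E (\<lambda>W. row_sum n h W u * row_sum n h W u)"
      using s0 c(3) by (intro integral_mono int mult_left_le_one_le) (auto simp: s_def)
    also have "\<dots> = ?ER (\<lambda>S. measure_pmf.expectation (iid ?B d R)
        (\<lambda>W. (\<Sum>x\<in>?B. h S (W x)) * (\<Sum>x\<in>?B. h S (W x))))"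
      using u R by (subst expectation_Pi_pmf_remove[where u = u]) (auto simp: row_sum_def intro!: Bochner_Integration.integral_cong sum.cong arg_cong2[where f = "(*)"])
    also have "\<dots> \<le> ?ER (\<lambda>S. 2 * (real n * p)\<^sup>2 * (a S)\<^sup>2)"
      by (intro integral_mono int' inner)
    finally show ?thesis by simp
  qed
  have off: "?E (\<lambda>W. s (W u) (W v) * (row_sum n h W u * row_sum n h W v)) \<le>
      5 * (real n * p)\<^sup>2 * (\<Sum>w\<in>I. (?ER (\<lambda>S. c w S * a S))\<^sup>2)" if uv: "u < n" "v < n" "u \<noteq> v" for u v
  proof -
    let ?B = "{..<n} - {u} - {v}"
    have k: "card ?B \<le> n"
      by (metis card_mono card_lessThan finite_lessThan Diff_subset subset_trans)
    \<comment> \<open>The summand 1 in each factor bounds the contribution of \<open>u\<close> and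
      \<open>v\<close> to each other's row sum; the remaining sums involve only the other
      coordinates. Both sums use the same coordinates, so they are not independent and
      \<open>expectation_sum_times_sum_le\<close> is needed.\<close>
    have inner: "s S T * measure_pmf.expectation (iid ?B d R)
        (\<lambda>W. (1 + (\<Sum>x\<in>?B. h S (W x))) * (1 + (\<Sum>x\<in>?B. h T (W x)))) \<le>
        s S T * (5 * (real n * p)\<^sup>2 * (a S * a T))" for S T
    proof (cases "s S T = 0")
      case False
      then obtain w where "w \<in> I" "c w S * c w T \<noteq> 0" unfolding s_def by (meson sum.not_neutral_contains_not_neutral)
      then have a1: "1 \<le> a S" "1 \<le> a T" using c(2) by auto
      define x y where "x = real n * p * a S" and "y = real n * p * a T"
      have xy: "1 \<le> x" "1 \<le> y" unfolding x_def y_def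
        using mult_mono[OF np a1(1)] mult_mono[OF np a1(2)] np by auto
      have lin: "measure_pmf.expectation (iid ?B d R) (\<lambda>W. \<Sum>x\<in>?B. h S (W x)) =
          real (card ?B) * ?ER (h S)" for S
      proof -
        have "measure_pmf.expectation (iid ?B d R) (\<lambda>W. h S (W x)) = ?ER (h S)" if "x \<in> ?B" for x
          using that R by (simp add: expectation_Pi_pmf_remove[where u = x and A = ?B])
        then show ?thesis by simp
      qed
      have "measure_pmf.expectation (iid ?B d R)
          (\<lambda>W. (1 + (\<Sum>x\<in>?B. h S (W x))) * (1 + (\<Sum>x\<in>?B. h T (W x)))) =
          1 + real (card ?B) * ?ER (h S) + real (card ?B) * ?ER (h T) +
          measure_pmf.expectation (iid ?B d R) (\<lambda>W. (\<Sum>x\<in>?B. h S (W x)) * (\<Sum>x\<in>?B. h T (W x)))"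
        unfolding lin[symmetric]
        by (simp add: distrib_left distrib_right del: Bochner_Integration.integral_sum)
      also have "\<dots> \<le> 1 + real (card ?B) * ?ER (h S) + real (card ?B) * ?ER (h T) +
          ((real (card ?B))\<^sup>2 * (?ER (h S) * ?ER (h T)) + real (card ?B) * ?ER (h S))"
        by (intro add_left_mono expectation_sum_times_sum_le) (use R h in auto)
      also have "\<dots> = 1 + 2 * (real (card ?B) * ?ER (h S)) + real (card ?B) * ?ER (h T) +
          (real (card ?B) * ?ER (h S)) * (real (card ?B) * ?ER (h T))"
        by (simp add: power2_eq_square algebra_simps)
      also have "\<dots> \<le> 1 + 2 * x + y + x * y"
        unfolding x_def y_def
        by (intro add_mono mult_mono ng k mult_nonneg_nonneg g0 a0 order_refl) (use p0 in auto)
      \<comment> \<open>Origin of the constant 5: with \<open>x\<close> and \<open>y\<close> at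
        least 1, each of 1, \<open>x\<close>, \<open>x\<close>, \<open>y\<close> and
        \<open>x * y\<close> is at most \<open>x * y\<close>.\<close>
      also have "\<dots> \<le> 5 * (x * y)"
      proof -
        have "x \<le> x * y" "y \<le> x * y" "1 \<le> x * y"
          using xy mult_mono[of 1 x 1 y] by (auto simp: mult_le_cancel_left1 mult_le_cancel_right1)
        then show ?thesis by linarith
      qed
      also have "\<dots> = 5 * (real n * p)\<^sup>2 * (a S * a T)"
        by (simp add: x_def y_def power2_eq_square algebra_simps)
      finally show ?thesis using s0 by (intro mult_left_mono)
    qed simp
    have row_le: "row_sum n h (W(u := S, v := T)) u \<le> 1 + (\<Sum>x\<in>?B. h S (W x))"
      "row_sum n h (W(v := T, u := S)) v \<le> 1 + (\<Sum>x\<in>?B. h T (W x))"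
      "0 \<le> row_sum n h W z" for W S T z
    proof -
      have "row_sum n h (W(u := S, v := T)) u = h S T + (\<Sum>x\<in>?B. h S (W x))"
        using uv unfolding row_sum_def
        by (subst sum.remove[of _ v]) (auto intro!: sum.cong)
      then show "row_sum n h (W(u := S, v := T)) u \<le> 1 + (\<Sum>x\<in>?B. h S (W x))" using h by simp
      have "row_sum n h (W(v := T, u := S)) v = h T S + (\<Sum>x\<in>?B. h T (W x))"
        using uv unfolding row_sum_def
        by (subst sum.remove[of _ u]) (auto intro!: sum.cong)
      then show "row_sum n h (W(v := T, u := S)) v \<le> 1 + (\<Sum>x\<in>?B. h T (W x))" using h by simp
      show "0 \<le> row_sum n h W z" unfolding row_sum_def using h by (intro sum_nonneg)
    qed
    have "?E (\<lambda>W. s (W u) (W v) * (row_sum n h W u * row_sum n h W v)) =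
        ?ER (\<lambda>S. ?ER (\<lambda>T. measure_pmf.expectation (iid ?B d R)
          (\<lambda>W. s S T * (row_sum n h (W(u := S, v := T)) u * row_sum n h (W(u := S, v := T)) v))))"
      using uv R by (simp add: expectation_Pi_pmf_remove[where u = u and A = "{..<n}"]
          expectation_Pi_pmf_remove[where u = v and A = "{..<n} - {u}"] fun_upd_twist)
    also have "\<dots> \<le> ?ER (\<lambda>S. ?ER (\<lambda>T. measure_pmf.expectation (iid ?B d R)
          (\<lambda>W. s S T * ((1 + (\<Sum>x\<in>?B. h S (W x))) * (1 + (\<Sum>x\<in>?B. h T (W x)))))))"
    proof (intro integral_mono int int' mult_left_mono s0 mult_mono row_le)
      show "row_sum n h (W(u := S, v := T)) v \<le> 1 + (\<Sum>x\<in>?B. h T (W x))" for W S T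
        by (subst fun_upd_twist) (use uv row_le(2) in auto)
      show "0 \<le> 1 + (\<Sum>x\<in>?B. h S (W x))" for W S
        using h by (intro add_nonneg_nonneg sum_nonneg) auto
    qed auto
    also have "\<dots> \<le> ?ER (\<lambda>S. ?ER (\<lambda>T. s S T * (5 * (real n * p)\<^sup>2 * (a S * a T))))"
      by (intro integral_mono int') (use inner in simp)
    \<comment> \<open>Each class contributes a function of \<open>S\<close> times the same function
      of \<open>T\<close>, so the double expectation becomes a sum of squares.\<close>
    also have "(\<lambda>S T. s S T * (5 * (real n * p)\<^sup>2 * (a S * a T))) =
        (\<lambda>S T. 5 * (real n * p)\<^sup>2 * (\<Sum>w\<in>I. (c w S * a S) * (c w T * a T)))"
      by (intro ext) (simp add: s_def sum_distrib_left sum_distrib_right mult_ac)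
    also have "?ER (\<lambda>S. ?ER (\<lambda>T. 5 * (real n * p)\<^sup>2 * (\<Sum>w\<in>I. (c w S * a S) * (c w T * a T)))) =
        5 * (real n * p)\<^sup>2 * (\<Sum>w\<in>I. (?ER (\<lambda>S. c w S * a S))\<^sup>2)"
    proof -
      have "?ER (\<lambda>T. 5 * (real n * p)\<^sup>2 * (\<Sum>w\<in>I. (c w S * a S) * (c w T * a T))) =
          5 * (real n * p)\<^sup>2 * (\<Sum>w\<in>I. (c w S * a S) * ?ER (\<lambda>T. c w T * a T))" for S
        by (simp only: integral_mult_right_zero Bochner_Integration.integral_sum[OF int'])
      then show ?thesis
        by (simp only: integral_mult_right_zero integral_mult_left_zero
            Bochner_Integration.integral_sum[OF int'] power2_eq_square)
    qed
    finally show ?thesis .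
  qed
  have split: "(\<Sum>u<n. \<Sum>v<n. F u v) = (\<Sum>u<n. F u u) + (\<Sum>(u, v)\<in>off_diag n. F u v)"
    for F :: "nat \<Rightarrow> nat \<Rightarrow> real"
  proof -
    have "(\<Sum>u<n. \<Sum>v<n. F u v) = (\<Sum>(u, v)\<in>{..<n} \<times> {..<n}. F u v)"
      by (simp add: sum.cartesian_product)
    also have "\<dots> = (\<Sum>(u, v)\<in>off_diag n. F u v) + (\<Sum>(u, v)\<in>(\<lambda>u. (u, u)) ` {..<n}. F u v)"
      unfolding off_diag_altdef by (rule sum.subset_diff) auto
    also have "(\<Sum>(u, v)\<in>(\<lambda>u. (u, u)) ` {..<n}. F u v) = (\<Sum>u<n. F u u)"
      by (subst sum.reindex) (auto simp: inj_on_def)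
    finally show ?thesis by simp
  qed
  let ?X = "5 * (real n * p)\<^sup>2 * (\<Sum>w\<in>I. (?ER (\<lambda>S. c w S * a S))\<^sup>2)"
  let ?Y = "2 * (real n * p)\<^sup>2 * ?ER (\<lambda>S. (a S)\<^sup>2)"
  have X0: "0 \<le> ?X" by (intro mult_nonneg_nonneg sum_nonneg) auto
  have "?E (\<lambda>W. \<Sum>u<n. \<Sum>v<n. s (W u) (W v) * (row_sum n h W u * row_sum n h W v)) =
      (\<Sum>u<n. ?E (\<lambda>W. s (W u) (W u) * (row_sum n h W u * row_sum n h W u))) +
      (\<Sum>(u, v)\<in>off_diag n. ?E (\<lambda>W. s (W u) (W v) * (row_sum n h W u * row_sum n h W v)))"
    unfolding split by (simp add: case_prod_unfold)
  also have "\<dots> \<le> (\<Sum>u<n. ?Y) + (\<Sum>(u, v)\<in>off_diag n. ?X)"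
    using diag off by (intro add_mono sum_mono) (auto simp: off_diag_def)
  also have "\<dots> = real n * ?Y + real (card (off_diag n)) * ?X"
    by (simp add: case_prod_unfold)
  also have "\<dots> \<le> real n * ?Y + (real n)\<^sup>2 * ?X"
    using X0 by (intro add_left_mono mult_right_mono)
      (auto simp: card_off_diag power2_eq_square algebra_simps)
  finally show ?thesis unfolding s_def by (simp add: mult_ac)
qed

subsection \<open>Moments of a random attribute set\<close>

text \<open>Second-order counterpart of Bernoulli's inequality, needed to bound adjacency
  probabilities from below. In the induction step the two leftover terms are negative.\<close>

lemma one_minus_power_le:
  fixes p :: real
  assumes "0 \<le> p" "p \<le> 1"
  shows "(1 - p) ^ k \<le> 1 - real k * p + (real k * p)\<^sup>2 / 2"
proof (induction k)
  case (Suc k)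
  have "(1 - p) ^ Suc k \<le> (1 - p) * (1 - real k * p + (real k * p)\<^sup>2 / 2)"
    using Suc assms by (simp add: mult_left_mono)
  also have "\<dots> = 1 - real (Suc k) * p + (real (Suc k) * p)\<^sup>2 / 2 - p\<^sup>2 / 2 - (real k)\<^sup>2 * p ^ 3 / 2"
    by (simp add: power2_eq_square power3_eq_cube algebra_simps add_divide_distrib diff_divide_distrib)
  also have "\<dots> \<le> 1 - real (Suc k) * p + (real (Suc k) * p)\<^sup>2 / 2"
  proof -
    have "0 \<le> p\<^sup>2 / 2" "0 \<le> (real k)\<^sup>2 * p ^ 3 / 2" using assms by simp_all
    then show ?thesis by linarith
  qed
  finally show ?case .
qed simp

text \<open>This is sinh x \<ge> x multiplied by 2 exp(-x). The difference vanishes at 0, and its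
  derivative is nonnegative because exp(-y) \<ge> 1 - y.\<close>

lemma one_minus_exp_ge:
  fixes x :: real
  assumes "0 \<le> x"
  shows "2 * x * exp (- x) \<le> 1 - exp (- (2 * x))"
proof -
  have "(\<lambda>x. 1 - exp (- (2 * x)) - 2 * x * exp (- x)) 0 \<le>
      (\<lambda>x. 1 - exp (- (2 * x)) - 2 * x * exp (- x :: real)) x"
  proof (rule DERIV_nonneg_imp_nondecreasing[OF assms])
    fix y :: real assume y: "0 \<le> y" "y \<le> x"
    have "((\<lambda>x. 1 - exp (- (2 * x)) - 2 * x * exp (- x)) has_real_derivative
        2 * exp (- y) * (exp (- y) - (1 - y))) (at y)"
      by (auto intro!: derivative_eq_intros simp: algebra_simps simp flip: exp_add)
    moreover have "0 \<le> 2 * exp (- y) * (exp (- y) - (1 - y))"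
      using exp_ge_add_one_self[of "- y"] by (intro mult_nonneg_nonneg) auto
    ultimately show "\<exists>z. ((\<lambda>x. 1 - exp (- (2 * x)) - 2 * x * exp (- x)) has_real_derivative z) (at y) \<and> 0 \<le> z"
      by blast
  qed
  then show ?thesis by simp
qed

lemma set_pmf_random_subset: "S \<in> set_pmf (random_subset m p) \<Longrightarrow> S \<subseteq> {..<m}"
  by (auto simp: random_subset_def)

lemma finite_random_subset [simp]: "finite (set_pmf (random_subset m p))"
  by (rule finite_subset[of _ "Pow {..<m}"]) (auto dest: set_pmf_random_subset)

lemma integrable_random_subset [simp]:
  "integrable (measure_pmf (random_subset m p)) (F :: _ \<Rightarrow> real)"
  by (rule integrable_measure_pmf_finite) simp

text \<open>The event is a box in independent coordinates, each attribute of \<open>T\<close>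
  contributing \<open>p\<close> and each attribute of \<open>F\<close> contributing
  \<open>1 - p\<close>. Membership, avoiding a set and having a given least element are all of this
  shape, so the moments below reduce to it.\<close>

lemma expectation_random_subset_of_bool:
  assumes p: "0 \<le> p" "p \<le> 1" and TF: "T \<subseteq> {..<m}" "F \<subseteq> {..<m}" "T \<inter> F = {}"
  shows "measure_pmf.expectation (random_subset m p) (\<lambda>S. of_bool (T \<subseteq> S \<and> S \<inter> F = {})) =
    p ^ card T * (1 - p) ^ card F"
proof -
  let ?P = "Pi_pmf {..<m} False (\<lambda>_. bernoulli_pmf p)"
  let ?B = "\<lambda>w. if w \<in> T then {True} else if w \<in> F then {False} else UNIV"
  have "measure_pmf.expectation (random_subset m p) (\<lambda>S. of_bool (T \<subseteq> S \<and> S \<inter> F = {}) :: real) =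
      measure_pmf.expectation ?P (indicator (Pi {..<m} ?B) :: _ \<Rightarrow> real)"
    unfolding random_subset_def integral_map_pmf
    by (intro Bochner_Integration.integral_cong refl) (use TF in \<open>auto simp: indicator_def Pi_def\<close>)
  also have "\<dots> = measure_pmf.prob ?P (Pi {..<m} ?B)" by simp
  also have "\<dots> = (\<Prod>w<m. measure_pmf.prob (bernoulli_pmf p) (?B w))"
    by (intro measure_Pi_pmf_Pi) simp
  also have "\<dots> = (\<Prod>w<m. (if w \<in> T then p else 1) * (if w \<in> F then 1 - p else 1))"
    using p TF by (intro prod.cong) (auto simp: measure_pmf_single)
  also have "\<dots> = p ^ card T * (1 - p) ^ card F"
    using TF by (simp add: prod.distrib prod.If_cases Int_absorb1)
  finally show ?thesis .
qed

text \<open>Intersecting with \<open>{..<m}\<close> changes nothing for attribute sets, but makes the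
  estimates on \<open>meets S\<close> below true for every \<open>S\<close>, including infinite ones.\<close>

definition subset_size :: "nat \<Rightarrow> nat set \<Rightarrow> real" where
  "subset_size m S = real (card (S \<inter> {..<m}))"

definition meets :: "nat set \<Rightarrow> nat set \<Rightarrow> real" where
  "meets S T = of_bool (S \<inter> T \<noteq> {})"

text \<open>Phrased without \<open>Min\<close>, so that the empty set has no least attribute rather
  than an unspecified one.\<close>

definition is_min :: "nat \<Rightarrow> nat set \<Rightarrow> real" where
  "is_min w S = of_bool (w \<in> S \<and> S \<inter> {..<w} = {})"

text \<open>A sum of products, so that expectations over independent sets factorise term by term; it
  vanishes when either set is empty.\<close>

definition same_min :: "nat \<Rightarrow> nat set \<Rightarrow> nat set \<Rightarrow> real" where
  "same_min m S T = (\<Sum>w<m. is_min w S * is_min w T)"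

text \<open>The collision probability of the least attribute: attribute \<open>w\<close> is least
  when it is present and the \<open>w\<close> smaller ones are absent.\<close>

definition prob_same_min :: "nat \<Rightarrow> real \<Rightarrow> real" where
  "prob_same_min m p = (\<Sum>w<m. (p * (1 - p) ^ w)\<^sup>2)"

definition prob_meets :: "nat \<Rightarrow> real \<Rightarrow> real" where
  "prob_meets m p = measure_pmf.expectation (random_subset m p)
     (\<lambda>S. measure_pmf.expectation (random_subset m p) (meets S))"

lemma subset_size_sum: "subset_size m S = (\<Sum>w<m. of_bool (w \<in> S))"
  by (simp add: subset_size_def sum_of_bool_eq Int_commute)

lemma subset_size_cases: "subset_size m S = 0 \<or> 1 \<le> subset_size m S"
  by (cases "card (S \<inter> {..<m})") (auto simp: subset_size_def)

lemma is_min_01: "0 \<le> is_min w S" "is_min w S \<le> 1" "is_min w S * is_min w S = is_min w S"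
  by (auto simp: is_min_def)

lemma is_min_size: "w < m \<Longrightarrow> is_min w S \<noteq> 0 \<Longrightarrow> 1 \<le> subset_size m S"
  by (auto simp: is_min_def subset_size_def Suc_le_eq card_gt_0_iff)

lemma sum_is_min_le: "(\<Sum>w<m. is_min w S) \<le> 1"
proof -
  have "card {w \<in> {..<m}. w \<in> S \<and> S \<inter> {..<w} = {}} \<le> 1"
    unfolding One_nat_def
    by (subst card_le_Suc0_iff_eq) (auto, metis linorder_neqE_nat disjoint_iff lessThan_iff)
  then show ?thesis by (simp add: is_min_def sum_of_bool_eq Int_def)
qed

lemma same_min_sym: "same_min m S T = same_min m T S"
  by (simp add: same_min_def mult.commute)

lemma same_min_01: "0 \<le> same_min m S T" "same_min m S T \<le> 1"
proof -
  show "0 \<le> same_min m S T" unfolding same_min_def by (intro sum_nonneg mult_nonneg_nonneg is_min_01)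
  have "same_min m S T \<le> (\<Sum>w<m. is_min w S)"
    unfolding same_min_def by (intro sum_mono mult_left_le is_min_01)
  then show "same_min m S T \<le> 1" using sum_is_min_le[where m = m and S = S] by linarith
qed

context
  fixes m :: nat and p :: real
  assumes p: "0 \<le> p" "p \<le> 1"
begin

abbreviation "ER \<equiv> measure_pmf.expectation (random_subset m p)"

lemma expectation_mem: "w < m \<Longrightarrow> ER (\<lambda>S. of_bool (w \<in> S)) = p"
  using expectation_random_subset_of_bool[OF p, of "{w}" m "{}"] by simp

lemma expectation_subset_size: "ER (subset_size m) = real m * p"
  by (subst subset_size_sum[abs_def]) (simp add: expectation_mem del: sum_of_bool_eq)

lemma expectation_subset_size_sq: "ER (\<lambda>S. (subset_size m S)\<^sup>2) \<le> real m * p + (real m * p)\<^sup>2"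
proof -
  have "ER (\<lambda>S. (subset_size m S)\<^sup>2) = (\<Sum>w<m. \<Sum>w'<m. ER (\<lambda>S. of_bool ({w, w'} \<subseteq> S \<and> S \<inter> {} = {})))"
    by (simp add: subset_size_sum power2_eq_square sum_product del: sum_of_bool_eq flip: of_bool_conj)
  also have "\<dots> \<le> (\<Sum>w<m. \<Sum>w'<m. of_bool (w' = w) * p + p\<^sup>2)"
    by (intro sum_mono, subst expectation_random_subset_of_bool)
      (use p in \<open>auto simp: card_insert_if power2_eq_square\<close>)
  also have "\<dots> = (\<Sum>w<m. p + real m * p\<^sup>2)"
    by (intro sum.cong) (auto simp: sum.distrib of_bool_def if_distrib[of "\<lambda>z. z * _"] cong: if_cong)
  also have "\<dots> = real m * p + (real m * p)\<^sup>2"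
    by (simp add: power2_eq_square algebra_simps)
  finally show ?thesis .
qed

lemma expectation_meets: "ER (meets S) = 1 - (1 - p) ^ card (S \<inter> {..<m})"
proof -
  have "ER (meets S) = ER (\<lambda>T. 1 - of_bool ({} \<subseteq> T \<and> T \<inter> (S \<inter> {..<m}) = {}))"
    by (intro integral_cong_AE AE_pmfI) (auto simp: meets_def dest!: set_pmf_random_subset)
  also have "\<dots> = 1 - (1 - p) ^ card (S \<inter> {..<m})"
    using expectation_random_subset_of_bool[OF p, of "{}" m "S \<inter> {..<m}"] by simp
  finally show ?thesis .
qed

lemma expectation_meets_le: "ER (meets S) \<le> p * subset_size m S"
  using Bernoulli_inequality[of "- p" "card (S \<inter> {..<m})"] p
  by (simp add: expectation_meets subset_size_def mult.commute)

lemma expectation_meets_ge: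
  "p * subset_size m S - p\<^sup>2 / 2 * (subset_size m S)\<^sup>2 \<le> ER (meets S)"
  using one_minus_power_le[OF p, of "card (S \<inter> {..<m})"]
  by (simp add: expectation_meets subset_size_def power_mult_distrib mult.commute)

lemma prob_meets_le: "prob_meets m p \<le> real m * p\<^sup>2"
proof -
  have "prob_meets m p \<le> ER (\<lambda>S. p * subset_size m S)"
    unfolding prob_meets_def by (intro integral_mono expectation_meets_le) auto
  also have "\<dots> = real m * p\<^sup>2"
    by (simp add: expectation_subset_size power2_eq_square)
  finally show ?thesis .
qed

text \<open>Average the second-order lower bound for a fixed set and insert the first two moments of
  the set size.\<close>

lemma prob_meets_ge: "real m * p\<^sup>2 * (1 - (p + real m * p\<^sup>2) / 2) \<le> prob_meets m p"
proof -
  have "real m * p\<^sup>2 * (1 - (p + real m * p\<^sup>2) / 2) =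
      p * (real m * p) - p\<^sup>2 / 2 * (real m * p + (real m * p)\<^sup>2)"
    by (simp add: power2_eq_square field_simps)
  also have "\<dots> \<le> p * ER (subset_size m) - p\<^sup>2 / 2 * ER (\<lambda>S. (subset_size m S)\<^sup>2)"
    unfolding expectation_subset_size
    by (intro diff_left_mono mult_left_mono expectation_subset_size_sq) auto
  also have "\<dots> = ER (\<lambda>S. p * subset_size m S - p\<^sup>2 / 2 * (subset_size m S)\<^sup>2)"
    by simp
  also have "\<dots> \<le> prob_meets m p"
    unfolding prob_meets_def by (intro integral_mono expectation_meets_ge) auto
  finally show ?thesis .
qed

text \<open>Supplies the \<open>K\<close> of \<open>pair_sum_moments\<close> for adjacency. The
  conditional probability is at most \<open>p\<close> times the set size, whose second moment is
  known; the main part (m p^2)^2 is then compared with the square of \<open>prob_meets\<close>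
  through its lower bound.\<close>

lemma expectation_meets_sq:
  assumes small: "p + real m * p\<^sup>2 \<le> 1"
  shows "ER (\<lambda>S. (ER (meets S))\<^sup>2) \<le>
    (prob_meets m p)\<^sup>2 + (p\<^sup>2 * (real m * p) + (real m * p\<^sup>2)\<^sup>2 * (p + real m * p\<^sup>2))"
proof -
  define \<mu> t where "\<mu> = real m * p\<^sup>2" and "t = p + real m * p\<^sup>2"
  have "0 \<le> \<mu>" by (simp add: \<mu>_def)
  have "0 \<le> ER (meets S)" for S by (intro integral_nonneg_AE) (auto simp: meets_def)
  then have "ER (\<lambda>S. (ER (meets S))\<^sup>2) \<le> ER (\<lambda>S. (p * subset_size m S)\<^sup>2)"
    by (intro integral_mono power_mono expectation_meets_le) auto
  also have "\<dots> = p\<^sup>2 * ER (\<lambda>S. (subset_size m S)\<^sup>2)"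
    by (simp add: power_mult_distrib)
  also have "\<dots> \<le> p\<^sup>2 * (real m * p + (real m * p)\<^sup>2)"
    by (intro mult_left_mono expectation_subset_size_sq) auto
  also have "\<dots> = p\<^sup>2 * (real m * p) + \<mu>\<^sup>2 * 1"
    by (simp add: \<mu>_def power2_eq_square algebra_simps)
  \<comment> \<open>Indeed (1 - t/2)^2 + t = 1 + t^2/4.\<close>
  also have "\<mu>\<^sup>2 * 1 \<le> \<mu>\<^sup>2 * ((1 - t / 2)\<^sup>2 + t)"
    by (intro mult_left_mono) (auto simp: power2_eq_square field_simps)
  also have "\<dots> = (\<mu> * (1 - t / 2))\<^sup>2 + \<mu>\<^sup>2 * t"
    by (simp add: power_mult_distrib distrib_left)
  also have "(\<mu> * (1 - t / 2))\<^sup>2 \<le> (prob_meets m p)\<^sup>2"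
    using prob_meets_ge small \<open>0 \<le> \<mu>\<close> by (intro power_mono) (auto simp: \<mu>_def t_def)
  finally show ?thesis by (simp add: \<mu>_def t_def)
qed

lemma expectation_is_min: "w < m \<Longrightarrow> ER (is_min w) = p * (1 - p) ^ w"
  using expectation_random_subset_of_bool[OF p, of "{w}" m "{..<w}"]
  by (simp add: is_min_def[abs_def])

text \<open>Given that \<open>w\<close> is least, \<open>w\<close> itself counts once, smaller
  attributes are absent, and each larger one is present with probability \<open>p\<close>.\<close>

lemma expectation_is_min_size:
  assumes "w < m"
  shows "ER (\<lambda>S. is_min w S * subset_size m S) \<le> p * (1 - p) ^ w * (1 + real m * p)"
proof -
  have "ER (\<lambda>S. is_min w S * subset_size m S) =
      (\<Sum>w'<m. ER (\<lambda>S. of_bool ({w, w'} \<subseteq> S \<and> S \<inter> {..<w} = {})))"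
  proof -
    have "is_min w S * subset_size m S = (\<Sum>w'<m. of_bool ({w, w'} \<subseteq> S \<and> S \<inter> {..<w} = {}))" for S
      unfolding is_min_def subset_size_sum sum_distrib_left by (intro sum.cong) auto
    then show ?thesis
      by (simp only: Bochner_Integration.integral_sum[OF integrable_random_subset])
  qed
  also have "\<dots> \<le> (\<Sum>w'<m. of_bool (w' = w) * (p * (1 - p) ^ w) + p\<^sup>2 * (1 - p) ^ w)"
  proof (intro sum_mono)
    fix w' assume w': "w' \<in> {..<m}"
    show "ER (\<lambda>S. of_bool ({w, w'} \<subseteq> S \<and> S \<inter> {..<w} = {})) \<le>
        of_bool (w' = w) * (p * (1 - p) ^ w) + p\<^sup>2 * (1 - p) ^ w"
    proof (cases "w' < w")
      case True
      then have "(\<lambda>S. of_bool ({w, w'} \<subseteq> S \<and> S \<inter> {..<w} = {}) :: real) = (\<lambda>_. 0)"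
        by (auto simp: fun_eq_iff)
      then show ?thesis using p by simp
    next
      case False
      then show ?thesis using assms w' p
        by (subst expectation_random_subset_of_bool) (auto simp: card_insert_if power2_eq_square)
    qed
  qed
  also have "\<dots> = p * (1 - p) ^ w * (1 + real m * p)"
    using assms
    by (simp add: sum.distrib of_bool_def if_distrib[of "\<lambda>z. z * _"] cong: if_cong)
      (simp add: power2_eq_square algebra_simps)
  finally show ?thesis .
qed

lemma expectation_same_min_left: "ER (same_min m S) = (\<Sum>w<m. is_min w S * (p * (1 - p) ^ w))"
  by (simp add: same_min_def[abs_def] expectation_is_min)

lemma expectation_same_min: "ER (\<lambda>S. ER (same_min m S)) = prob_same_min m p"
  by (simp add: expectation_same_min_left expectation_is_min
      prob_same_min_def power2_eq_square)

text \<open>For a fixed set the conditional probability is 0 or some p (1 - p)^w, hence at most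
  \<open>p\<close>; bounding one of the two factors by \<open>p\<close> leaves the mean.\<close>

lemma expectation_same_min_sq: "ER (\<lambda>S. (ER (same_min m S))\<^sup>2) \<le> p * prob_same_min m p"
proof -
  have le: "0 \<le> ER (same_min m S)" "ER (same_min m S) \<le> p" for S
  proof -
    show "0 \<le> ER (same_min m S)" by (intro integral_nonneg_AE) (auto simp: same_min_01)
    have "ER (same_min m S) \<le> (\<Sum>w<m. is_min w S * p)"
      unfolding expectation_same_min_left
      by (intro sum_mono mult_left_mono is_min_01 mult_left_le power_le_one) (use p in auto)
    also have "\<dots> \<le> 1 * p"
      unfolding sum_distrib_right[symmetric] using sum_is_min_le p by (intro mult_right_mono) auto
    finally show "ER (same_min m S) \<le> p" by simp
  qed
  have "ER (\<lambda>S. (ER (same_min m S))\<^sup>2) \<le> ER (\<lambda>S. p * ER (same_min m S))"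
    unfolding power2_eq_square by (intro integral_mono mult_right_mono le) auto
  also have "\<dots> = p * prob_same_min m p" by (simp add: expectation_same_min)
  finally show ?thesis .
qed

text \<open>A geometric series of ratio (1 - p)^2. As 1 - (1 - p)^2 \<le> 2p, it is at least p (1 -
  (1 - p)^(2m)) / 2; then (1 - p)^(2m) \<le> exp(-2mp), and \<open>one_minus_exp_ge\<close> applies
  at x = mp.\<close>

lemma prob_same_min_ge: "real m * p\<^sup>2 * exp (- (real m * p)) \<le> prob_same_min m p"
proof (cases "p = 0")
  case False
  then have p0: "0 < p" using p by simp
  have "prob_same_min m p = p\<^sup>2 * (\<Sum>w<m. ((1 - p)\<^sup>2) ^ w)"
    by (simp add: prob_same_min_def power_mult_distrib sum_distrib_left mult.commute flip: power_mult)
  moreover have "1 - ((1 - p)\<^sup>2) ^ m = (1 - (1 - p)\<^sup>2) * (\<Sum>w<m. ((1 - p)\<^sup>2) ^ w)"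
    by (rule one_diff_power_eq)
  moreover have "\<dots> \<le> (2 * p) * (\<Sum>w<m. ((1 - p)\<^sup>2) ^ w)"
    by (intro mult_right_mono sum_nonneg zero_le_power zero_le_power2)
      (simp add: power2_eq_square algebra_simps)
  ultimately have "p * (1 - ((1 - p)\<^sup>2) ^ m) \<le> 2 * prob_same_min m p"
    using p0 mult_left_mono[of "1 - ((1 - p)\<^sup>2) ^ m" "(2 * p) * (\<Sum>w<m. ((1 - p)\<^sup>2) ^ w)" p]
    by (simp add: power2_eq_square mult_ac)
  moreover have "((1 - p)\<^sup>2) ^ m \<le> exp (- (2 * (real m * p)))"
  proof -
    have "(1 - p) ^ (2 * m) \<le> exp (- p) ^ (2 * m)"
      using p exp_ge_add_one_self[of "- p"] by (intro power_mono) auto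
    then show ?thesis by (simp add: mult_ac flip: power_mult exp_of_nat_mult)
  qed
  moreover have "2 * (real m * p) * exp (- (real m * p)) \<le> 1 - exp (- (2 * (real m * p)))"
    using p by (intro one_minus_exp_ge) auto
  ultimately have "p * (2 * (real m * p) * exp (- (real m * p))) \<le> 2 * prob_same_min m p"
    using p0 by (smt (verit) mult_left_mono)
  then show ?thesis by (simp add: power2_eq_square mult_ac)
qed (unfold prob_same_min_def, simp add: sum_nonneg)

end

subsection \<open>Modularity of the partition by least attribute\<close>

text \<open>The ordered adjacent pairs split into disjoint fibres over the edges, each fibre being
  the two orderings of one edge.\<close>

lemma num_edges_in_intersection_graph:
  assumes "finite V" "S \<subseteq> V"
  shows "2 * num_edges_in (intersection_graph V W) S =
    card {(u, v). u \<in> S \<and> v \<in> S \<and> u \<noteq> v \<and> W u \<inter> W v \<noteq> {}}"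
proof -
  let ?E = "{e \<in> edges (intersection_graph V W). e \<subseteq> S}"
  let ?D = "\<lambda>e. {(u, v). e = {u, v}}"
  have E: "\<exists>u v. e = {u, v} \<and> u \<in> S \<and> v \<in> S \<and> u \<noteq> v \<and> W u \<inter> W v \<noteq> {}" if "e \<in> ?E" for e
    using that by (auto simp: intersection_graph_def)
  have card2: "finite (?D e) \<and> card (?D e) = 2" if e: "e \<in> ?E" for e
  proof -
    from E[OF e] obtain u v where uv: "e = {u, v}" "u \<noteq> v" by auto
    then have "?D e = {(u, v), (v, u)}" by (auto simp: doubleton_eq_iff)
    then show ?thesis using uv by auto
  qed
  have "finite ?E"
    by (rule finite_subset[of _ "Pow V"]) (use assms in auto)
  have "{(u, v). u \<in> S \<and> v \<in> S \<and> u \<noteq> v \<and> W u \<inter> W v \<noteq> {}} = (\<Union>e\<in>?E. ?D e)"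
  proof (intro equalityI subsetI)
    fix z assume "z \<in> {(u, v). u \<in> S \<and> v \<in> S \<and> u \<noteq> v \<and> W u \<inter> W v \<noteq> {}}"
    then show "z \<in> (\<Union>e\<in>?E. ?D e)"
      using assms by (force simp: intersection_graph_def)
  next
    fix z assume "z \<in> (\<Union>e\<in>?E. ?D e)"
    then obtain e where "e \<in> ?E" "z \<in> ?D e" by blast
    with E[of e] show "z \<in> {(u, v). u \<in> S \<and> v \<in> S \<and> u \<noteq> v \<and> W u \<inter> W v \<noteq> {}}"
      by (fastforce simp: doubleton_eq_iff)
  qed
  then have "card {(u, v). u \<in> S \<and> v \<in> S \<and> u \<noteq> v \<and> W u \<inter> W v \<noteq> {}} = (\<Sum>e\<in>?E. card (?D e))"
    using card2 \<open>finite ?E\<close> by (simp only:) (rule card_UN_disjoint, auto)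
  also have "\<dots> = 2 * card ?E" using card2 by simp
  finally show ?thesis by (simp add: num_edges_in_def)
qed

lemma degree_intersection_graph:
  assumes "u \<in> V"
  shows "degree (intersection_graph V W) u = card {v \<in> V. u \<noteq> v \<and> W u \<inter> W v \<noteq> {}}"
proof -
  have "{e \<in> edges (intersection_graph V W). u \<in> e} =
      (\<lambda>v. {u, v}) ` {v \<in> V. u \<noteq> v \<and> W u \<inter> W v \<noteq> {}}"
    using assms by (auto simp: intersection_graph_def insert_commute)
  then show ?thesis
    unfolding degree_def by (simp add: card_image inj_on_def doubleton_eq_iff)
qed

lemma modularity_ge:
  assumes "finite (verts G)" "partition_on (verts G) \<A>"
  shows "modularity_of G \<A> \<le> modularity G"
  unfolding modularity_def
  by (rule Max_ge[OF modularity_set_finite_nonempty(1)]) (use assms in auto)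

text \<open>Connects the kernel with the partition into classes. Nonemptiness is stated explicitly
  because \<open>Min {}\<close> is unspecified.\<close>

lemma same_min_eq:
  assumes "S \<subseteq> {..<m}" "T \<subseteq> {..<m}"
  shows "same_min m S T = of_bool (S \<noteq> {} \<and> T \<noteq> {} \<and> Min S = Min T)"
proof -
  have is_min: "is_min w S = of_bool (S \<noteq> {} \<and> w = Min S)" if "S \<subseteq> {..<m}" for w S
  proof -
    have "finite S" using that finite_subset by blast
    then show ?thesis
      by (cases "S = {}") (auto simp: is_min_def of_bool_def disjoint_iff not_less
          intro!: Min_eqI[symmetric] elim: Min_in dest: leD)
  qed
  have "same_min m S T = (\<Sum>w<m. if w = Min S then of_bool (S \<noteq> {} \<and> T \<noteq> {} \<and> Min S = Min T) else 0)"
    unfolding same_min_def by (intro sum.cong) (auto simp: is_min assms)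
  also have "\<dots> = of_bool (S \<noteq> {} \<and> T \<noteq> {} \<and> Min S = Min T)"
  proof (cases "S = {}")
    case False
    then have "Min S \<in> {..<m}" using assms(1) Min_in[of S] finite_subset[of S "{..<m}"] by blast
    then show ?thesis by simp
  qed simp
  finally show ?thesis .
qed

lemma pair_sum_conv_row_sum: "pair_sum n f W = (\<Sum>u<n. row_sum n f W u)"
proof -
  have "pair_sum n f W = (\<Sum>(u, v)\<in>Sigma {..<n} (\<lambda>u. {..<n} - {u}). f (W u) (W v))"
    unfolding pair_sum_def by (intro sum.cong) (auto simp: off_diag_def)
  then show ?thesis by (simp add: sum.Sigma row_sum_def)
qed

text \<open>A deterministic bound. \<open>pair_sum n meets W\<close> is the volume and twice the
  edge number, the numerator with \<open>same_min m\<close> is at most twice the number of edges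
  inside classes, and the double sum is the sum of squared class volumes.\<close>

lemma modularity_intersection_graph_ge:
  fixes W :: "nat \<Rightarrow> nat set"
  assumes W: "\<And>v. v < n \<Longrightarrow> W v \<subseteq> {..<m}" and pos: "0 < pair_sum n meets W"
  defines "G \<equiv> intersection_graph {..<n} W"
  shows "edges G \<noteq> {}"
    and "pair_sum n (same_min m) W / pair_sum n meets W -
      (\<Sum>u<n. \<Sum>v<n. same_min m (W u) (W v) * (row_sum n meets W u * row_sum n meets W v)) /
        (pair_sum n meets W)\<^sup>2 \<le> modularity G"
proof -
  \<comment> \<open>The vertices without attributes form the additional class \<open>m\<close>; they are isolated, so it
    has no edges and no volume.\<close>
  define c where "c = (\<lambda>v. if W v = {} then m else Min (W v))"
  define C where "C = (\<lambda>k. {v \<in> {..<n}. c v = k})"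
  define \<A> where "\<A> = C ` c ` {..<n}"
  let ?U = "pair_sum n meets W"
  let ?d = "row_sum n meets W"
  have V: "verts G = {..<n}" by (simp add: G_def intersection_graph_def)
  have part: "partition_on {..<n} \<A>"
    by (rule partition_onI) (auto simp: \<A>_def C_def disjnt_def)
  \<comment> \<open>Only labels that occur are used, so the classes are nonempty and sums over the
    partition can be reindexed by labels.\<close>
  have inj: "inj_on C (c ` {..<n})" by (auto simp: inj_on_def C_def)
  have deg: "real (degree G u) = ?d u" if "u < n" for u
  proof -
    have "{v. v < n \<and> u \<noteq> v \<and> W u \<inter> W v \<noteq> {}} = ({..<n} - {u}) \<inter> {v. W u \<inter> W v \<noteq> {}}" by auto
    then show ?thesis
      using that by (simp add: G_def degree_intersection_graph row_sum_def meets_def sum_of_bool_eq)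
  qed
  have vol: "real (vol G S) = (\<Sum>u\<in>S. ?d u)" if "S \<subseteq> {..<n}" for S
    using that by (auto simp: vol_def deg subset_iff intro!: sum.cong)
  have volV: "real (vol G (verts G)) = ?U"
    unfolding V by (subst vol) (simp_all add: pair_sum_conv_row_sum)
  have num: "2 * real (num_edges_in G S) =
      (\<Sum>(u, v)\<in>off_diag n. of_bool (u \<in> S \<and> v \<in> S) * meets (W u) (W v))" if "S \<subseteq> {..<n}" for S
  proof -
    have "2 * real (num_edges_in G S) = real (2 * num_edges_in G S)" by simp
    also have "2 * num_edges_in G S = card {(u, v). u \<in> S \<and> v \<in> S \<and> u \<noteq> v \<and> W u \<inter> W v \<noteq> {}}"
      unfolding G_def using that by (intro num_edges_in_intersection_graph) auto
    also have "{(u, v). u \<in> S \<and> v \<in> S \<and> u \<noteq> v \<and> W u \<inter> W v \<noteq> {}} =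
        off_diag n \<inter> {(u, v). (u \<in> S \<and> v \<in> S) \<and> W u \<inter> W v \<noteq> {}}"
      using that by (auto simp: off_diag_def)
    finally show ?thesis
      by (simp add: meets_def case_prod_unfold sum_of_bool_eq flip: of_bool_conj)
  qed
  have card_edges: "2 * real (card (edges G)) = ?U"
  proof -
    have "num_edges_in G {..<n} = card (edges G)"
      unfolding num_edges_in_def by (rule arg_cong[of _ _ card]) (auto simp: G_def intersection_graph_def)
    then show ?thesis
      using num[of "{..<n}"]
      by (simp add: pair_sum_def) (intro sum.cong, auto simp: off_diag_def)
  qed
  show "edges G \<noteq> {}" using card_edges pos by auto
  \<comment> \<open>Two vertices with the same least attribute share that attribute, hence are
    adjacent; the term of their common label already accounts for the pair.\<close>
  have e_sum: "pair_sum n (same_min m) W \<le> (\<Sum>k\<in>c ` {..<n}. 2 * real (num_edges_in G (C k)))"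
  proof -
    have "(\<Sum>k\<in>c ` {..<n}. 2 * real (num_edges_in G (C k))) =
        (\<Sum>k\<in>c ` {..<n}. \<Sum>(u, v)\<in>off_diag n. of_bool (u \<in> C k \<and> v \<in> C k) * meets (W u) (W v))"
      by (intro sum.cong num refl) (auto simp: C_def)
    also have "\<dots> = (\<Sum>(u, v)\<in>off_diag n. \<Sum>k\<in>c ` {..<n}. of_bool (u \<in> C k \<and> v \<in> C k) * meets (W u) (W v))"
      by (subst sum.swap) (simp add: case_prod_unfold)
    finally have eq: "(\<Sum>k\<in>c ` {..<n}. 2 * real (num_edges_in G (C k))) = \<dots>" .
    have "same_min m (W u) (W v) \<le> (\<Sum>k\<in>c ` {..<n}. of_bool (u \<in> C k \<and> v \<in> C k) * meets (W u) (W v))"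
      if uv: "u < n" "v < n" for u v
    proof (cases "W u \<noteq> {} \<and> W v \<noteq> {} \<and> Min (W u) = Min (W v)")
      case True
      have "finite (W u)" "finite (W v)" using W uv finite_subset by blast+
      then have "Min (W u) \<in> W u \<inter> W v" using True by (metis Min_in IntI)
      then have "meets (W u) (W v) = 1" by (auto simp: meets_def)
      moreover have "(\<Sum>k\<in>{c u}. of_bool (u \<in> C k \<and> v \<in> C k) * meets (W u) (W v)) \<le>
          (\<Sum>k\<in>c ` {..<n}. of_bool (u \<in> C k \<and> v \<in> C k) * meets (W u) (W v))"
        using uv by (intro sum_mono2) (auto simp: meets_def)
      ultimately show ?thesis using True uv by (simp add: C_def c_def W same_min_eq)
    next
      case False
      then show ?thesis using uv by (auto simp: W same_min_eq meets_def intro!: sum_nonneg)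
    qed
    then show ?thesis unfolding eq pair_sum_def by (intro sum_mono) (auto simp: off_diag_def)
  qed
  have vol_sum: "(\<Sum>k\<in>c ` {..<n}. (real (vol G (C k)))\<^sup>2) =
      (\<Sum>u<n. \<Sum>v<n. same_min m (W u) (W v) * (?d u * ?d v))"
  proof -
    have "(\<Sum>k\<in>c ` {..<n}. (real (vol G (C k)))\<^sup>2) = (\<Sum>k\<in>c ` {..<n}. \<Sum>u\<in>C k. \<Sum>v\<in>C k. ?d u * ?d v)"
      by (intro sum.cong refl, subst vol) (auto simp: C_def power2_eq_square sum_product)
    also have "\<dots> = (\<Sum>k\<in>c ` {..<n}. \<Sum>u\<in>C k. \<Sum>v<n. same_min m (W u) (W v) * (?d u * ?d v))"
    proof (rule sum.cong[OF refl], rule sum.cong[OF refl])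
      fix k u assume u: "u \<in> C k"
      have "(\<Sum>v\<in>C k. ?d u * ?d v) = (\<Sum>v<n. if c v = k then ?d u * ?d v else 0)"
        unfolding C_def by (intro sum.inter_filter) auto
      also have "\<dots> = (\<Sum>v<n. same_min m (W u) (W v) * (?d u * ?d v))"
      proof (intro sum.cong refl)
        fix v assume v: "v \<in> {..<n}"
        have empty: "?d u = 0" if "W u = {}" for u
          using that by (simp add: row_sum_def meets_def)
        have nonempty: "Min (W u) < m" if "u < n" "W u \<noteq> {}" for u
        proof -
          have "Min (W u) \<in> {..<m}"
            using W[OF that(1)] that(2) Min_in[of "W u"] finite_subset[of "W u" "{..<m}"] by blast
          then show ?thesis by simp
        qed
        show "(if c v = k then ?d u * ?d v else 0) = same_min m (W u) (W v) * (?d u * ?d v)"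
          using u v nonempty[of u] nonempty[of v]
          by (cases "W u = {}"; cases "W v = {}") (auto simp: C_def c_def same_min_eq W empty)
      qed
      finally show "(\<Sum>v\<in>C k. ?d u * ?d v) = (\<Sum>v<n. same_min m (W u) (W v) * (?d u * ?d v))" .
    qed
    also have "\<dots> = (\<Sum>u<n. \<Sum>v<n. same_min m (W u) (W v) * (?d u * ?d v))"
      unfolding C_def by (rule sum.group) auto
    finally show ?thesis .
  qed
  have "pair_sum n (same_min m) W / ?U -
      (\<Sum>u<n. \<Sum>v<n. same_min m (W u) (W v) * (?d u * ?d v)) / ?U\<^sup>2 \<le>
      (\<Sum>k\<in>c ` {..<n}. 2 * real (num_edges_in G (C k))) / ?U - (\<Sum>k\<in>c ` {..<n}. (real (vol G (C k)))\<^sup>2) / ?U\<^sup>2"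
    unfolding vol_sum using e_sum pos by (intro diff_right_mono divide_right_mono) auto
  also have "\<dots> = modularity_of G \<A>"
    unfolding modularity_of_def \<A>_def sum.reindex[OF inj] volV card_edges[symmetric]
    by (simp add: sum_subtractf sum_divide_distrib power_divide)
  also have "\<dots> \<le> modularity G"
    using part by (intro modularity_ge) (auto simp: V)
  finally show "pair_sum n (same_min m) W / ?U -
      (\<Sum>u<n. \<Sum>v<n. same_min m (W u) (W v) * (?d u * ?d v)) / ?U\<^sup>2 \<le> modularity G" .
qed

subsection \<open>Quantitative bound and the limit\<close>

text \<open>The arithmetic on the good event, with \<open>U\<close> the volume, \<open>Uin\<close>
  the pairs with equal least attribute and \<open>V\<close> the sum of squared class volumes. The
  quotient \<open>Uin / U\<close> loses a factor 1 - 2\<delta>, and the volume term costs one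
  further \<delta>.\<close>

lemma ratio_bound:
  fixes U Uin V N \<theta> \<eta> \<mu> \<delta> Q :: real
  assumes \<delta>: "0 < \<delta>" "\<delta> \<le> 1 / 3" and N: "0 < N" and \<mu>: "0 < \<mu>"
    and M: "N\<^sup>2 / 2 \<le> M" and \<theta>: "\<mu> / 2 \<le> \<theta>" "\<theta> \<le> \<mu>" and \<eta>: "\<mu> * Q \<le> \<eta>" "0 < \<eta>"
    and U: "(1 - \<delta>) * (M * \<theta>) \<le> U" "U \<le> (1 + \<delta>) * (M * \<theta>)"
    and Uin: "(1 - \<delta>) * (M * \<eta>) \<le> Uin" and V: "V \<le> \<delta> * \<eta> * N ^ 4 * \<mu> / 36"
  shows "0 < U" "(1 - 3 * \<delta>) * Q \<le> Uin / U - V / U\<^sup>2"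
proof -
  have M0: "0 < M" using M N by (smt (verit) zero_less_power divide_pos_pos)
  \<comment> \<open>Here \<delta> \<le> 1/3 gives 1 - \<delta> \<ge> 2/3, and 2/3 * 1/2 * 1/2 =
    1/6.\<close>
  have "2 / 3 * (N\<^sup>2 / 2 * (\<mu> / 2)) \<le> (1 - \<delta>) * (M * \<theta>)"
    using \<delta> M \<theta> \<mu> M0 by (intro mult_mono) auto
  with U have U_ge: "N\<^sup>2 * \<mu> / 6 \<le> U" by linarith
  moreover have "0 < N\<^sup>2 * \<mu> / 6" using N \<mu> by simp
  ultimately show U0: "0 < U" by linarith
  have "(1 - 2 * \<delta>) * (\<eta> / \<mu>) \<le> Uin / U"
  proof -
    have "(1 - 2 * \<delta>) * (1 + \<delta>) \<le> 1 - \<delta>" using \<delta> by (simp add: algebra_simps)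
    then have "((1 - 2 * \<delta>) * (1 + \<delta>)) * (M * \<eta>) \<le> (1 - \<delta>) * (M * \<eta>)"
      using M0 \<eta> by (intro mult_right_mono) auto
    also have "\<dots> \<le> Uin" by (rule Uin)
    also have "((1 - 2 * \<delta>) * (1 + \<delta>)) * (M * \<eta>) =
        (1 - 2 * \<delta>) * (\<eta> / \<mu>) * ((1 + \<delta>) * (M * \<mu>))"
      using \<mu> by simp
    finally have 1: "(1 - 2 * \<delta>) * (\<eta> / \<mu>) * ((1 + \<delta>) * (M * \<mu>)) \<le> Uin" .
    have "U \<le> (1 + \<delta>) * (M * \<mu>)"
      using U(2) \<theta> M0 \<delta> by (smt (verit) mult_left_mono)
    then have "(1 - 2 * \<delta>) * (\<eta> / \<mu>) * U \<le> (1 - 2 * \<delta>) * (\<eta> / \<mu>) * ((1 + \<delta>) * (M * \<mu>))"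
      using \<delta> \<eta> \<mu> by (intro mult_left_mono mult_nonneg_nonneg) auto
    with 1 show ?thesis using U0 by (simp add: pos_le_divide_eq)
  qed
  moreover have "V / U\<^sup>2 \<le> \<delta> * (\<eta> / \<mu>)"
  proof -
    \<comment> \<open>The square of 1/6 explains the 36 in the hypothesis on
      \<open>V\<close>.\<close>
    have "(N\<^sup>2 * \<mu> / 6)\<^sup>2 \<le> U\<^sup>2" using U_ge \<mu> by (intro power_mono) auto
    then have "\<delta> * (\<eta> / \<mu>) * (N\<^sup>2 * \<mu> / 6)\<^sup>2 \<le> \<delta> * (\<eta> / \<mu>) * U\<^sup>2"
      using \<delta> \<eta> \<mu> by (intro mult_left_mono) auto
    moreover have "\<delta> * (\<eta> / \<mu>) * (N\<^sup>2 * \<mu> / 6)\<^sup>2 = \<delta> * \<eta> * N ^ 4 * \<mu> / 36"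
      using \<mu> by (simp add: power2_eq_square power4_eq_xxxx)
    ultimately have "V \<le> \<delta> * (\<eta> / \<mu>) * U\<^sup>2" using V by linarith
    then show ?thesis using U0 by (simp add: pos_divide_le_eq)
  qed
  moreover have "(1 - 3 * \<delta>) * Q \<le> (1 - 3 * \<delta>) * (\<eta> / \<mu>)"
    using \<delta> \<eta> \<mu> by (intro mult_left_mono) (auto simp: field_simps)
  moreover have "(1 - 3 * \<delta>) * (\<eta> / \<mu>) = (1 - 2 * \<delta>) * (\<eta> / \<mu>) - \<delta> * (\<eta> / \<mu>)"
    by (simp add: left_diff_distrib diff_divide_distrib)
  ultimately show "(1 - 3 * \<delta>) * Q \<le> Uin / U - V / U\<^sup>2" by linarith
qed

text \<open>Three bad events: the volume deviates (\<open>B1\<close>), the count of pairs with equal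
  least attribute deviates (\<open>B2\<close>), or the squared class volumes are large
  (\<open>B3\<close>). Their bounds have constants 72 + 20 + 504 = 596, rounded to 600.\<close>

lemma modularity_random_intersection_graph:
  fixes m n :: nat and p \<delta> :: real
  assumes p: "0 \<le> p" "p \<le> 1" and small: "p + real m * p\<^sup>2 \<le> 1" and m: "0 < m" and n: "2 \<le> n"
    and dense: "1 \<le> real n * p * exp (- (real m * p))" and \<delta>: "0 < \<delta>" "\<delta> \<le> 1 / 3"
  shows "1 - 600 / \<delta>\<^sup>2 * (1 / real m + p + real m * p\<^sup>2) \<le>
    measure_pmf.prob (random_intersection_graph n m p)
      {G. edges G \<noteq> {} \<and> (1 - 3 * \<delta>) * exp (- (real m * p)) \<le> modularity G}"
proof -
  define R where "R = random_subset m p"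
  define P where "P = iid {..<n} {} R"
  define \<theta> \<eta> \<mu> Q lam M N err where "\<theta> = prob_meets m p" and "\<eta> = prob_same_min m p"
    and "\<mu> = real m * p\<^sup>2" and "Q = exp (- (real m * p))" and "lam = real m * p"
    and "M = real n * (real n - 1)" and "N = real n" and "err = 1 / real m + p + real m * p\<^sup>2"
  note defs = \<theta>_def \<eta>_def \<mu>_def Q_def lam_def M_def N_def err_def
  have finR: "finite (set_pmf R)" by (simp add: R_def)
  have Q: "0 < Q" "Q \<le> 1" using p by (auto simp: Q_def)
  have NpQ: "1 \<le> N * p * Q" using dense by (simp add: N_def Q_def)
  have N: "2 \<le> N" using n by (simp add: N_def)
  have p0: "0 < p" using NpQ p by (cases "p = 0") auto
  have mm: "1 \<le> real m" using m by simp
  have Np: "1 \<le> N * p"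
  proof -
    have "N * p * Q \<le> N * p * 1" using Q N p by (intro mult_left_mono) auto
    then show ?thesis using NpQ by simp
  qed
  have \<mu>: "0 < \<mu>" "p + \<mu> \<le> 1" using p0 m small by (auto simp: \<mu>_def)
  have lam: "0 < lam" using p0 m by (simp add: lam_def)
  have M: "N\<^sup>2 / 2 \<le> M"
  proof -
    have "0 \<le> N * (N - 2)" using N by simp
    then show ?thesis by (simp add: M_def N_def power2_eq_square algebra_simps)
  qed
  have \<theta>: "\<mu> / 2 \<le> \<theta>" "\<theta> \<le> \<mu>"
  proof -
    have "\<mu> * (1 / 2) \<le> \<mu> * (1 - (p + \<mu>) / 2)" using \<mu> by (intro mult_left_mono) auto
    then show "\<mu> / 2 \<le> \<theta>" using prob_meets_ge[OF p, of m] by (simp add: defs)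
    show "\<theta> \<le> \<mu>" using prob_meets_le[OF p, of m] by (simp add: defs)
  qed
  have \<eta>: "\<mu> * Q \<le> \<eta>" using prob_same_min_ge[OF p, of m] by (simp add: defs)
  have \<eta>0: "0 < \<eta>" using \<eta> \<mu> Q by (smt (verit) mult_pos_pos)
  \<comment> \<open>The density hypothesis enters here in full strength: \<eta> is at least \<mu> *
    Q, and the loss \<open>Q\<close> is compensated by N * p * Q \<ge> 1.\<close>
  have N\<eta>: "lam \<le> N * \<eta>"
  proof -
    have "lam * 1 \<le> lam * (N * p * Q)" using NpQ lam by (intro mult_left_mono) auto
    also have "\<dots> = N * (\<mu> * Q)" by (simp add: lam_def \<mu>_def power2_eq_square)
    also have "\<dots> \<le> N * \<eta>" using \<eta> N by (intro mult_left_mono) auto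
    finally show ?thesis by simp
  qed
  have Nlam: "real m \<le> N * lam"
    using mult_left_mono[OF Np, of "real m"] by (simp add: lam_def mult_ac)
  have NN\<eta>: "real m \<le> N\<^sup>2 * \<eta>"
  proof -
    have "N * lam \<le> N * (N * \<eta>)" using N\<eta> N by (intro mult_left_mono) auto
    with Nlam show ?thesis by (simp add: power2_eq_square mult.assoc)
  qed
  have NN\<mu>: "real m \<le> N\<^sup>2 * \<mu>"
  proof -
    have "1 * 1 \<le> (N * p) * (N * p)" using Np by (intro mult_mono) auto
    then have "real m * 1 \<le> real m * ((N * p) * (N * p))" by (intro mult_left_mono) auto
    then show ?thesis by (simp add: \<mu>_def power2_eq_square mult_ac)
  qed
  have err: "1 / real m \<le> err" "p + \<mu> \<le> err" "1 / real m + \<mu> \<le> err" "0 \<le> err"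
    using p by (auto simp: defs)

  define B1 where "B1 = {W. \<bar>pair_sum n meets W - M * \<theta>\<bar> \<ge> \<delta> * (M * \<theta>)}"
  define B2 where "B2 = {W. \<bar>pair_sum n (same_min m) W - M * \<eta>\<bar> \<ge> \<delta> * (M * \<eta>)}"
  define V where "V = (\<lambda>W. \<Sum>u<n. \<Sum>v<n. same_min m (W u) (W v) *
    (row_sum n meets W u * row_sum n meets W v))"
  \<comment> \<open>With high probability \<open>pair_sum n meets W\<close> is at least \<open>N\<^sup>2 * \<mu> / 6\<close>, so that \<open>t\<close> divided by
    its square is at most \<open>\<delta> * \<eta> / \<mu>\<close>.\<close>
  define t where "t = \<delta> * \<eta> * N ^ 4 * \<mu> / 36"
  define B3 where "B3 = {W. t \<le> V W}"

  have Np3: "0 < N" "0 < M" "0 < \<theta>" using N M \<theta> \<mu> by (auto intro: less_le_trans[of _ "N\<^sup>2 / 2"])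

  have B1: "measure_pmf.prob P B1 \<le> 72 / \<delta>\<^sup>2 * err"
  proof -
    \<comment> \<open>The covariance bound of \<open>expectation_meets_sq\<close>; divided by
      \<mu>^2 it is 1/lam + p + \<mu>, and N * lam \<ge> m turns the first part into an error
      1/m.\<close>
    define K where "K = p\<^sup>2 * lam + \<mu>\<^sup>2 * (p + \<mu>)"
    have K0: "0 \<le> K" using p lam \<mu> by (simp add: K_def)
    have "measure_pmf.prob P B1 \<le> (2 * M * \<theta> + 4 * real n ^ 3 * K) / (\<delta> * (M * \<theta>))\<^sup>2"
      unfolding P_def B1_def M_def
    proof (rule pair_sum_concentration[OF finR])
      show "meets S T = meets T S" for S T by (simp add: meets_def Int_commute)
      show "\<theta> = measure_pmf.expectation R (\<lambda>s. measure_pmf.expectation R (meets s))"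
        by (simp add: \<theta>_def prob_meets_def R_def)
      show "measure_pmf.expectation R (\<lambda>s. (measure_pmf.expectation R (meets s))\<^sup>2) \<le> \<theta>\<^sup>2 + K"
        using expectation_meets_sq[OF p small] by (simp add: R_def K_def defs)
      show "0 < real n * (real n - 1) * \<theta>" using Np3 by (simp add: M_def)
    qed (use \<delta> K0 in \<open>auto simp: meets_def\<close>)
    also have "\<dots> = 2 / (\<delta>\<^sup>2 * (M * \<theta>)) + 4 * N ^ 3 * K / (\<delta>\<^sup>2 * (M * \<theta>)\<^sup>2)"
      using Np3 \<delta> by (simp add: add_divide_distrib power2_eq_square N_def mult_ac)
    also have "\<dots> \<le> 2 / (\<delta>\<^sup>2 * (N\<^sup>2 * \<mu> / 4)) + 4 * N ^ 3 * K / (\<delta>\<^sup>2 * (N\<^sup>2 * \<mu> / 4)\<^sup>2)"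
    proof -
      have "N\<^sup>2 / 2 * (\<mu> / 2) \<le> M * \<theta>" using M \<theta> \<mu> Np3 by (intro mult_mono) auto
      then show ?thesis
        using Np3 \<delta> K0 \<mu> by (intro add_mono divide_left_mono mult_left_mono power_mono mult_pos_pos) auto
    qed
    also have "\<dots> = 8 / \<delta>\<^sup>2 * (1 / (N\<^sup>2 * \<mu>)) + 64 / \<delta>\<^sup>2 * (1 / (N * lam) + (p + \<mu>) / N)"
    proof -
      have "K / \<mu>\<^sup>2 = 1 / lam + (p + \<mu>)"
        using lam p0 m by (simp add: K_def \<mu>_def lam_def field_simps power2_eq_square)
      then have K: "K = \<mu>\<^sup>2 * (1 / lam + (p + \<mu>))" using \<mu> by (simp add: field_simps)
      have "4 * N ^ 3 * (\<mu>\<^sup>2 * X) / (\<delta>\<^sup>2 * (N\<^sup>2 * \<mu> / 4)\<^sup>2) = 64 / \<delta>\<^sup>2 * (X / N)" for X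
        using Np3 \<mu> \<delta> by (simp add: field_simps power2_eq_square power3_eq_cube)
      from this[of "1 / lam + (p + \<mu>)"] show ?thesis
        unfolding K by (simp only:) (simp add: add_divide_distrib mult_ac)
    qed
    also have "\<dots> \<le> 8 / \<delta>\<^sup>2 * (1 / real m) + 64 / \<delta>\<^sup>2 * (1 / real m + (p + \<mu>))"
    proof (intro add_mono mult_left_mono)
      show "1 / (N\<^sup>2 * \<mu>) \<le> 1 / real m" "1 / (N * lam) \<le> 1 / real m"
        using NN\<mu> Nlam mm by (auto intro!: divide_left_mono mult_pos_pos simp: Np3 \<mu> lam)
      show "(p + \<mu>) / N \<le> p + \<mu>"
        using N p \<mu> by (simp add: divide_le_eq mult_le_cancel_left1)
    qed auto
    also have "\<dots> \<le> 8 / \<delta>\<^sup>2 * err + 64 / \<delta>\<^sup>2 * err"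
      using err by (intro add_mono mult_left_mono) (auto simp: defs)
    also have "\<dots> = 72 / \<delta>\<^sup>2 * err" by (simp add: field_simps)
    finally show ?thesis .
  qed

  have B2: "measure_pmf.prob P B2 \<le> 20 / \<delta>\<^sup>2 * err"
  proof -
    have "measure_pmf.prob P B2 \<le> (2 * M * \<eta> + 4 * real n ^ 3 * (p * \<eta>)) / (\<delta> * (M * \<eta>))\<^sup>2"
      unfolding P_def B2_def M_def
    proof (rule pair_sum_concentration[OF finR same_min_sym same_min_01])
      show "\<eta> = measure_pmf.expectation R (\<lambda>s. measure_pmf.expectation R (same_min m s))"
        unfolding \<eta>_def R_def by (rule expectation_same_min[OF p, symmetric])
      have "measure_pmf.expectation R (\<lambda>s. (measure_pmf.expectation R (same_min m s))\<^sup>2) \<le> p * \<eta>"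
        unfolding \<eta>_def R_def by (rule expectation_same_min_sq[OF p])
      then show "measure_pmf.expectation R (\<lambda>s. (measure_pmf.expectation R (same_min m s))\<^sup>2) \<le> \<eta>\<^sup>2 + p * \<eta>"
        by (simp add: add_increasing)
      show "0 < real n * (real n - 1) * \<eta>" using Np3 \<eta>0 by (simp add: M_def)
    qed (use \<delta> p \<eta>0 in auto)
    also have "\<dots> = 2 / (\<delta>\<^sup>2 * (M * \<eta>)) + 4 * N ^ 3 * p / (\<delta>\<^sup>2 * (M\<^sup>2 * \<eta>))"
      using Np3 \<delta> \<eta>0 by (simp add: add_divide_distrib power2_eq_square N_def mult_ac)
    also have "\<dots> \<le> 2 / (\<delta>\<^sup>2 * (N\<^sup>2 / 2 * \<eta>)) + 4 * N ^ 3 * p / (\<delta>\<^sup>2 * ((N\<^sup>2 / 2)\<^sup>2 * \<eta>))"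
      using M Np3 \<delta> p \<eta>0
      by (intro add_mono divide_left_mono mult_left_mono mult_right_mono power_mono mult_pos_pos) auto
    also have "\<dots> = 4 / \<delta>\<^sup>2 * (1 / (N\<^sup>2 * \<eta>)) + 16 / \<delta>\<^sup>2 * (p / (N * \<eta>))"
      using Np3 \<delta> \<eta>0 by (simp add: field_simps power2_eq_square power3_eq_cube)
    also have "\<dots> \<le> 4 / \<delta>\<^sup>2 * (1 / real m) + 16 / \<delta>\<^sup>2 * (1 / real m)"
    proof (intro add_mono mult_left_mono)
      show "1 / (N\<^sup>2 * \<eta>) \<le> 1 / real m"
        using NN\<eta> mm by (auto intro!: divide_left_mono mult_pos_pos simp: Np3 \<eta>0)
      have "p / (N * \<eta>) \<le> p / lam"
        using N\<eta> lam p by (intro divide_left_mono) (auto simp: Np3 \<eta>0)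
      then show "p / (N * \<eta>) \<le> 1 / real m" using p0 by (simp add: lam_def)
    qed auto
    also have "\<dots> = 20 / \<delta>\<^sup>2 * (1 / real m)" by (simp add: field_simps)
    also have "\<dots> \<le> 20 / \<delta>\<^sup>2 * err" using err by (intro mult_left_mono) auto
    finally show ?thesis .
  qed

  have B3: "measure_pmf.prob P B3 \<le> 504 / \<delta>\<^sup>2 * err"
  proof -
    have intP: "integrable (measure_pmf P) F" for F :: "_ \<Rightarrow> real"
      unfolding P_def
      by (intro integrable_measure_pmf_finite finite_set_Pi_pmf) (use finR in auto)
    have t0: "0 < t" using \<delta> \<eta>0 \<mu> Np3 by (simp add: t_def)
    have "measure_pmf.expectation P V \<le>
        5 * (real n)\<^sup>2 * (real n * p)\<^sup>2 *
          (\<Sum>w<m. (measure_pmf.expectation R (\<lambda>S. is_min w S * subset_size m S))\<^sup>2) +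
        2 * real n * (real n * p)\<^sup>2 * measure_pmf.expectation R (\<lambda>S. (subset_size m S)\<^sup>2)"
      unfolding P_def V_def same_min_def
    proof (rule expectation_class_volumes_le[OF finR])
      show "measure_pmf.expectation R (meets S) \<le> p * subset_size m S" for S
        unfolding R_def by (rule expectation_meets_le[OF p])
      show "(\<Sum>w<m. is_min w S * is_min w S) \<le> 1" for S
        by (simp add: is_min_01 sum_is_min_le)
      show "1 \<le> real n * p" using Np by (simp add: N_def)
    qed (auto simp: meets_def subset_size_cases is_min_01 is_min_size)
    also have "\<dots> \<le> 5 * N\<^sup>2 * (N * p)\<^sup>2 * (\<Sum>w<m. (p * (1 - p) ^ w * (1 + lam))\<^sup>2) +
        2 * N * (N * p)\<^sup>2 * (lam + lam\<^sup>2)"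
      unfolding N_def lam_def R_def
    proof (intro add_mono mult_left_mono sum_mono power_mono expectation_subset_size_sq[OF p])
      show "0 \<le> measure_pmf.expectation (random_subset m p) (\<lambda>S. is_min w S * subset_size m S)" for w
        by (intro integral_nonneg_AE) (auto simp: is_min_01 subset_size_def)
      show "measure_pmf.expectation (random_subset m p) (\<lambda>S. is_min w S * subset_size m S) \<le>
          p * (1 - p) ^ w * (1 + real m * p)" if "w \<in> {..<m}" for w
        using that by (intro expectation_is_min_size[OF p]) auto
    qed auto
    also have "(\<Sum>w<m. (p * (1 - p) ^ w * (1 + lam))\<^sup>2) = \<eta> * (1 + lam)\<^sup>2"
      by (simp add: \<eta>_def prob_same_min_def sum_distrib_right power_mult_distrib)
    finally have EV: "measure_pmf.expectation P V \<le>
        5 * N\<^sup>2 * (N * p)\<^sup>2 * (\<eta> * (1 + lam)\<^sup>2) + 2 * N * (N * p)\<^sup>2 * (lam + lam\<^sup>2)" .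
    have V0: "0 \<le> V W" for W
      unfolding V_def row_sum_def
      by (intro sum_nonneg mult_nonneg_nonneg same_min_01) (auto simp: meets_def)
    have "measure_pmf.prob P B3 \<le> measure_pmf.expectation P V / t"
      using integral_Markov_inequality_measure[OF intP[of V], of UNIV t] t0
      by (simp add: B3_def V0)
    also have "\<dots> \<le> (5 * N\<^sup>2 * (N * p)\<^sup>2 * (\<eta> * (1 + lam)\<^sup>2) + 2 * N * (N * p)\<^sup>2 * (lam + lam\<^sup>2)) / t"
      using EV t0 by (simp add: divide_right_mono)
    \<comment> \<open>Both terms carry p^2/\<mu> = 1/m; the diagonal one has the extra factor lam/(N
      * \<eta>), at most 1 by \<open>N\<eta>\<close>.\<close>
    also have "\<dots> = 36 / \<delta> * (5 * (1 + lam)\<^sup>2 * (p\<^sup>2 / \<mu>) + 2 * (1 + lam) * (p\<^sup>2 / \<mu>) * (lam / (N * \<eta>)))"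
      using Np3 \<delta> \<eta>0 \<mu> unfolding t_def
      by (simp add: field_simps power2_eq_square power4_eq_xxxx)
    also have "p\<^sup>2 / \<mu> = 1 / real m" using p0 by (simp add: \<mu>_def)
    also have "36 / \<delta> * (5 * (1 + lam)\<^sup>2 * (1 / real m) + 2 * (1 + lam) * (1 / real m) * (lam / (N * \<eta>))) \<le>
        36 / \<delta> * (5 * (1 + lam)\<^sup>2 * (1 / real m) + 2 * (1 + lam)\<^sup>2 * (1 / real m) * 1)"
    proof (intro mult_left_mono add_left_mono mult_mono mult_right_mono)
      show "lam / (N * \<eta>) \<le> 1" using N\<eta> Np3 \<eta>0 by simp
      show "1 + lam \<le> (1 + lam)\<^sup>2" using lam by (simp add: power2_eq_square algebra_simps)
    qed (use lam \<delta> Np3 \<eta>0 in auto)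
    also have "\<dots> = 252 / \<delta> * ((1 + lam)\<^sup>2 / real m)" by (simp add: field_simps)
    also have "\<dots> \<le> 252 / \<delta> * (2 * err)"
    proof (intro mult_left_mono)
      \<comment> \<open>Since lam^2/m = \<mu>, the bound (1 + lam)^2 \<le> 2 + 2 lam^2 keeps the
        error small even when \<open>lam\<close> is unbounded.\<close>
      have "0 \<le> (1 - lam)\<^sup>2" by simp
      then have "(1 + lam)\<^sup>2 \<le> 2 + 2 * lam\<^sup>2" by (simp add: power2_eq_square algebra_simps)
      then have "(1 + lam)\<^sup>2 / real m \<le> (2 + 2 * lam\<^sup>2) / real m" by (rule divide_right_mono) simp
      also have "\<dots> = 2 * (1 / real m + \<mu>)"
        using m by (simp add: lam_def \<mu>_def field_simps power2_eq_square)
      also have "\<dots> \<le> 2 * err" using err(3) by (rule mult_left_mono) simp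
      finally show "(1 + lam)\<^sup>2 / real m \<le> 2 * err" .
    qed (use \<delta> in auto)
    also have "\<dots> = 504 / \<delta> * err" by simp
    also have "\<dots> \<le> 504 / \<delta>\<^sup>2 * err"
      using \<delta> err by (intro mult_right_mono divide_left_mono) (auto simp: power2_eq_square mult_le_cancel_left1)
    finally show ?thesis .
  qed

  let ?good = "{G. edges G \<noteq> {} \<and> (1 - 3 * \<delta>) * Q \<le> modularity G}"
  have good: "intersection_graph {..<n} W \<in> ?good"
    if W: "W \<in> set_pmf P" and nB: "W \<notin> B1 \<union> B2 \<union> B3" for W
  proof -
    have "W v \<subseteq> {..<m}" if "v < n" for v
    proof -
      have "W v \<in> set_pmf R"
        using W that by (auto simp: P_def set_Pi_pmf PiE_dflt_def)
      then show ?thesis unfolding R_def by (rule set_pmf_random_subset)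
    qed
    note graph = modularity_intersection_graph_ge[OF this]
    have U: "(1 - \<delta>) * (M * \<theta>) \<le> pair_sum n meets W" "pair_sum n meets W \<le> (1 + \<delta>) * (M * \<theta>)"
      "(1 - \<delta>) * (M * \<eta>) \<le> pair_sum n (same_min m) W" "V W \<le> \<delta> * \<eta> * N ^ 4 * \<mu> / 36"
      using nB by (auto simp: B1_def B2_def B3_def t_def algebra_simps)
    note bound = ratio_bound[OF \<delta> Np3(1) \<mu>(1) M \<theta> \<eta> \<eta>0 U]
    have "(1 - 3 * \<delta>) * Q \<le> modularity (intersection_graph {..<n} W)"
      using bound(2) graph(2)[OF _ bound(1)] unfolding V_def by linarith
    then show ?thesis using graph(1)[OF _ bound(1)] by simp
  qed
  have "1 - 600 / \<delta>\<^sup>2 * err \<le> 1 - measure_pmf.prob P (B1 \<union> B2 \<union> B3)"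
  proof -
    have "measure_pmf.prob P (B1 \<union> B2 \<union> B3) \<le>
        measure_pmf.prob P B1 + measure_pmf.prob P B2 + measure_pmf.prob P B3"
      using measure_Un_le[of "B1 \<union> B2" "measure_pmf P" B3] measure_Un_le[of B1 "measure_pmf P" B2] by simp
    also have "\<dots> \<le> 72 / \<delta>\<^sup>2 * err + 20 / \<delta>\<^sup>2 * err + 504 / \<delta>\<^sup>2 * err"
      by (intro add_mono B1 B2 B3)
    also have "\<dots> = 596 / \<delta>\<^sup>2 * err" by (simp add: field_simps)
    also have "\<dots> \<le> 600 / \<delta>\<^sup>2 * err"
      using err by (intro mult_right_mono divide_right_mono) auto
    finally show ?thesis by simp
  qed
  also have "\<dots> = measure_pmf.prob P (- (B1 \<union> B2 \<union> B3))"
    using measure_pmf.prob_compl[of "B1 \<union> B2 \<union> B3" P] by (simp add: Compl_eq_Diff_UNIV)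
  also have "\<dots> \<le> measure_pmf.prob P (intersection_graph {..<n} -` ?good)"
    using good by (intro measure_pmf.finite_measure_mono_AE AE_pmfI) auto
  also have "\<dots> = measure_pmf.prob (random_intersection_graph n m p) ?good"
    by (simp add: random_intersection_graph_altdef P_def R_def)
  finally show ?thesis by (simp add: err_def Q_def)
qed

section \<open>Passage to the limit\<close>

theorem theorem1:
  fixes m :: "nat \<Rightarrow> nat" and p :: "nat \<Rightarrow> real"
  assumes p_prob: "\<And>n. 0 \<le> p n \<and> p n \<le> 1"
    and m_lim: "filterlim m at_top sequentially"
    and p_lim: "p \<longlonglongrightarrow> 0"
    and mp2: "(\<lambda>n. real (m n) * (p n)\<^sup>2) \<in> o(\<lambda>_. 1)"
    and n2mp2: "filterlim (\<lambda>n. (real n)\<^sup>2 * real (m n) * (p n)\<^sup>2) at_top sequentially"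
  shows "\<exists>C>0. \<forall>\<epsilon>>0. \<exists>A::real. \<forall>\<^sub>F n in sequentially.
           real n * p n * exp (- (real (m n) * p n)) \<ge> A \<longrightarrow>
           measure_pmf.prob (random_intersection_graph n (m n) (p n))
             {G. edges G \<noteq> {} \<and>
                 modularity G \<ge> (1 - C * \<epsilon>) * exp (- (real (m n) * p n))}
           \<ge> 1 - \<epsilon>"
\<comment> \<open>The constant 3 is the loss 3\<delta> of the quantitative bound; the threshold 1
  serves every \<epsilon>.\<close>
proof (rule exI[of _ 3], intro conjI allI impI exI[of _ 1])
  fix \<epsilon> :: real assume \<epsilon>: "0 < \<epsilon>"
  \<comment> \<open>The quantitative bound requires \<delta> \<le> 1/3. Decreasing \<epsilon> to
    \<delta> only raises the lower bound on the modularity, while the failure probability is still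
    compared with \<epsilon>: \<delta> is fixed and the error tends to 0.\<close>
  define \<delta> where "\<delta> = min \<epsilon> (1 / 3)"
  have \<delta>: "0 < \<delta>" "\<delta> \<le> 1 / 3" "\<delta> \<le> \<epsilon>" using \<epsilon> by (auto simp: \<delta>_def)
  have mp2': "(\<lambda>n. real (m n) * (p n)\<^sup>2) \<longlonglongrightarrow> 0"
    using mp2 smalloD_tendsto[OF mp2] by simp
  have "(\<lambda>n. 1 / real (m n)) \<longlonglongrightarrow> 0"
    using filterlim_compose[OF filterlim_real_sequentially m_lim]
    by (intro real_tendsto_divide_at_top[OF tendsto_const]) (simp add: o_def)
  from tendsto_mult_right_zero[OF tendsto_add_zero[OF tendsto_add_zero[OF this p_lim] mp2'], of "600 / \<delta>\<^sup>2"]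
  have "(\<lambda>n. 600 / \<delta>\<^sup>2 * (1 / real (m n) + p n + real (m n) * (p n)\<^sup>2)) \<longlonglongrightarrow> 0" .
  then have err: "\<forall>\<^sub>F n in sequentially. 600 / \<delta>\<^sup>2 * (1 / real (m n) + p n + real (m n) * (p n)\<^sup>2) < \<epsilon>"
    using \<epsilon> by (rule order_tendstoD)
  have small: "\<forall>\<^sub>F n in sequentially. p n + real (m n) * (p n)\<^sup>2 < 1"
    using tendsto_add_zero[OF p_lim mp2'] by (rule order_tendstoD) simp
  have "\<forall>\<^sub>F n in sequentially. 0 < m n"
    using m_lim eventually_gt_at_top[of 0] unfolding filterlim_iff by blast
  with err small eventually_ge_at_top[of 2]
  show "\<forall>\<^sub>F n in sequentially. 1 \<le> real n * p n * exp (- (real (m n) * p n)) \<longrightarrow>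
      1 - \<epsilon> \<le> measure_pmf.prob (random_intersection_graph n (m n) (p n))
        {G. edges G \<noteq> {} \<and> (1 - 3 * \<epsilon>) * exp (- (real (m n) * p n)) \<le> modularity G}"
  proof eventually_elim
    case (elim n)
    show ?case
    proof
      assume "1 \<le> real n * p n * exp (- (real (m n) * p n))"
      then have "1 - 600 / \<delta>\<^sup>2 * (1 / real (m n) + p n + real (m n) * (p n)\<^sup>2) \<le>
          measure_pmf.prob (random_intersection_graph n (m n) (p n))
            {G. edges G \<noteq> {} \<and> (1 - 3 * \<delta>) * exp (- (real (m n) * p n)) \<le> modularity G}"
        using elim p_prob[of n] \<delta> by (intro modularity_random_intersection_graph) auto
      also have "\<dots> \<le> measure_pmf.prob (random_intersection_graph n (m n) (p n))
            {G. edges G \<noteq> {} \<and> (1 - 3 * \<epsilon>) * exp (- (real (m n) * p n)) \<le> modularity G}"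
      proof (intro measure_pmf.finite_measure_mono)
        have "(1 - 3 * \<epsilon>) * exp (- (real (m n) * p n)) \<le> (1 - 3 * \<delta>) * exp (- (real (m n) * p n))"
          using \<delta> by (intro mult_right_mono) auto
        then show "{G. edges G \<noteq> {} \<and> (1 - 3 * \<delta>) * exp (- (real (m n) * p n)) \<le> modularity G} \<subseteq>
            {G. edges G \<noteq> {} \<and> (1 - 3 * \<epsilon>) * exp (- (real (m n) * p n)) \<le> modularity G}"
          by (blast intro: order_trans)
      qed auto
      finally show "1 - \<epsilon> \<le> measure_pmf.prob (random_intersection_graph n (m n) (p n))
            {G. edges G \<noteq> {} \<and> (1 - 3 * \<epsilon>) * exp (- (real (m n) * p n)) \<le> modularity G}"
        using elim by linarith
    qed
  qed
qed auto

end
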